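(* Consider a second-order ordinary differential equation of the form $$y''+F_2(x,y)\,{y'}^2+F_1(x,y)\,y'+F(x,y)=0, \qquad ( * )$$ and for a function $g(x)$ of $x$ alone let $$h(x,y)=\int F_2(x,y)\,dy+g(x),$$ where $\int F_2(x,y)\,dy$ denotes a fixed antiderivative of $F_2$ with respect to $y$. Then equation $( * )$ is S-linearizable if and only if there exists a function $g(x)$ such that $$(F_1)_x+F_1h_x-h_x^2-h_{xx}-F_y-F\,F_2=0$$ holds identically in the two independent variables $(x,y)$.
   Context: Subscripts $x$ and $y$ on functions denote partial derivatives (so $(F_1)_x=\partial F_1/\partial x$, $h_x=\partial h/\partial x$, $F_y=\partial F/\partial y$, etc.), while $F_1,F_2$ are just names of coefficients; $y=y(x)$ and $'=d/dx$. All functions are smooth and real-valued, and all statements are local: fix a point $(x_0,y_0)$; every statement (S-linearizability, existence of $g$, the displayed identity) is understood on some sufficiently small open rectangle around $(x_0,y_0)$. A generalized Sundman transformation (S-transformation) is a (generally nonlocal) transformation $$u(t)=\psi(x,y),\qquad dt=\phi(x,y)\,dx,\qquad \psi_y\,\phi\neq 0 .$$ Under it, $u_t=\dfrac{\psi_x+\psi_y y'}{\phi}$ and $u_{tt}=\dfrac1\phi\,\dfrac{d}{dx}\!\left(\dfrac{\psi_x+\psi_y y'}{\phi}\right)$, where $\frac{d}{dx}$ is the total derivative along $y=y(x)$. The equation $( * )$ is called S-linearizable if it can be transformed into the free particle (Laguerre form) equation $u_{tt}=0$ by some generalized Sundman transformation. Equivalently, there exist functions $\psi,\phi$ with $\psi_y\phi\neq0$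 such that, with $A=\psi_y/\phi$ and $B=\psi_x/\phi$, $$A F_2=A_y,\qquad A F_1=B_y+A_x,\qquad A F=B_x .$$ *)

theory Defs
  imports "HOL-Analysis.Analysis"
begin

text \<open>
  Functions of two variables are curried. The partial derivatives below are built from
  \<^const>\<open>deriv\<close>, a total operator, so they are only meaningful where the function is known to be
  differentiable; everywhere they are used this is guaranteed by a smoothness hypothesis on an
  open set.
\<close>

definition partial_x :: "(real \<Rightarrow> real \<Rightarrow> real) \<Rightarrow> real \<Rightarrow> real \<Rightarrow> real" where
  "partial_x f x y = deriv (\<lambda>s. f s y) x"

definition partial_y :: "(real \<Rightarrow> real \<Rightarrow> real) \<Rightarrow> real \<Rightarrow> real \<Rightarrow> real" where
  "partial_y f x y = deriv (\<lambda>s. f x s) y"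

text \<open>Intended for open \<open>U\<close>: all partial derivatives up to order \<open>k\<close> exist and are continuous.\<close>

fun Ck_on :: "nat \<Rightarrow> (real \<times> real) set \<Rightarrow> (real \<Rightarrow> real \<Rightarrow> real) \<Rightarrow> bool" where
  "Ck_on 0 U f \<longleftrightarrow> continuous_on U (\<lambda>(x, y). f x y)"
| "Ck_on (Suc k) U f \<longleftrightarrow>
     continuous_on U (\<lambda>(x, y). f x y) \<and>
     (\<forall>(x, y)\<in>U. (\<lambda>s. f s y) differentiable (at x) \<and> (\<lambda>s. f x s) differentiable (at y)) \<and>
     Ck_on k U (partial_x f) \<and> Ck_on k U (partial_y f)"

definition smooth2_on :: "(real \<times> real) set \<Rightarrow> (real \<Rightarrow> real \<Rightarrow> real) \<Rightarrow> bool" where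
  "smooth2_on U f \<longleftrightarrow> (\<forall>k. Ck_on k U f)"

definition smooth1_on :: "real set \<Rightarrow> (real \<Rightarrow> real) \<Rightarrow> bool" where
  "smooth1_on I f \<longleftrightarrow> (\<forall>k. \<forall>x\<in>I. (deriv ^^ k) f differentiable (at x))"

definition satisfies_ode_at ::
    "(real \<Rightarrow> real \<Rightarrow> real) \<Rightarrow> (real \<Rightarrow> real \<Rightarrow> real) \<Rightarrow> (real \<Rightarrow> real \<Rightarrow> real) \<Rightarrow>
     (real \<Rightarrow> real) \<Rightarrow> real \<Rightarrow> bool" where
  "satisfies_ode_at F2 F1 F y x \<longleftrightarrow>
     deriv (deriv y) x + F2 x (y x) * (deriv y x)\<^sup>2 + F1 x (y x) * deriv y x + F x (y x) = 0"

definition sundman_transformation ::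
    "(real \<times> real) set \<Rightarrow> (real \<Rightarrow> real \<Rightarrow> real) \<Rightarrow> (real \<Rightarrow> real \<Rightarrow> real) \<Rightarrow> bool" where
  "sundman_transformation R \<psi> \<phi> \<longleftrightarrow>
     smooth2_on R \<psi> \<and> smooth2_on R \<phi> \<and> (\<forall>(x, y)\<in>R. partial_y \<psi> x y * \<phi> x y \<noteq> 0)"

text \<open>
  The curve \<open>y\<close> over the interval \<open>I\<close> is carried to \<open>u\<close>, where \<open>x \<mapsto> T x\<close> is the new independent
  variable \<open>t\<close> along \<open>y\<close>: \<open>dt = \<phi>(x,y) dx\<close> and \<open>u(t) = \<psi>(x,y)\<close>. The function \<open>T\<close> is determined up
  to an additive constant, and \<open>u\<close> is then determined on the open interval \<open>T ` I\<close>.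
\<close>

definition sundman_image ::
    "(real \<Rightarrow> real \<Rightarrow> real) \<Rightarrow> (real \<Rightarrow> real \<Rightarrow> real) \<Rightarrow> real set \<Rightarrow> (real \<Rightarrow> real) \<Rightarrow>
     (real \<Rightarrow> real) \<Rightarrow> (real \<Rightarrow> real) \<Rightarrow> bool" where
  "sundman_image \<psi> \<phi> I y T u \<longleftrightarrow>
     (\<forall>x\<in>I. (T has_real_derivative \<phi> x (y x)) (at x) \<and> u (T x) = \<psi> x (y x))"

text \<open>
  The transformation turns the equation into \<open>u\<^sub>t\<^sub>t = 0\<close>: along every smooth curve with graph in \<open>R\<close>,
  the two equations hold at exactly the same points, so they agree as relations between
  \<open>x, y, y', y''\<close>.
\<close>

definition transforms_to_free_particle ::
    "(real \<times> real) set \<Rightarrow> (real \<Rightarrow> real \<Rightarrow> real) \<Rightarrow> (real \<Rightarrow> real \<Rightarrow> real) \<Rightarrow> (real \<Rightarrow> real \<Rightarrow> real) \<Rightarrow>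
     (real \<Rightarrow> real \<Rightarrow> real) \<Rightarrow> (real \<Rightarrow> real \<Rightarrow> real) \<Rightarrow> bool" where
  "transforms_to_free_particle R F2 F1 F \<psi> \<phi> \<longleftrightarrow>
     (\<forall>p q y T u.
        smooth1_on {p<..<q} y \<and> (\<forall>x\<in>{p<..<q}. (x, y x) \<in> R) \<and>
        sundman_image \<psi> \<phi> {p<..<q} y T u \<longrightarrow>
        (\<forall>x\<in>{p<..<q}. satisfies_ode_at F2 F1 F y x \<longleftrightarrow> deriv (deriv u) (T x) = 0))"

definition open_rectangle_around :: "real \<Rightarrow> real \<Rightarrow> real set \<Rightarrow> real set \<Rightarrow> bool" where
  "open_rectangle_around x0 y0 I J \<longleftrightarrow>
     (\<exists>a b c d. I = {a<..<b} \<and> J = {c<..<d} \<and> x0 \<in> I \<and> y0 \<in> J)"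

definition S_linearizable_at ::
    "(real \<times> real) set \<Rightarrow> (real \<Rightarrow> real \<Rightarrow> real) \<Rightarrow> (real \<Rightarrow> real \<Rightarrow> real) \<Rightarrow> (real \<Rightarrow> real \<Rightarrow> real) \<Rightarrow>
     real \<Rightarrow> real \<Rightarrow> bool" where
  "S_linearizable_at U F2 F1 F x0 y0 \<longleftrightarrow>
     (\<exists>I J \<psi> \<phi>. open_rectangle_around x0 y0 I J \<and> I \<times> J \<subseteq> U \<and>
        sundman_transformation (I \<times> J) \<psi> \<phi> \<and>
        transforms_to_free_particle (I \<times> J) F2 F1 F \<psi> \<phi>)"

end

theory Submission
  imports Defs
begin

text \<open>
  Write \<open>A = \<psi>\<^sub>y/\<phi>\<close> and \<open>B = \<psi>\<^sub>x/\<phi>\<close>. Along a curve, \<open>u\<^sub>t = B + A y'\<close>, so testing on parabolas with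
  arbitrary 2-jet shows that the transformation linearizes the equation iff \<open>A F2 = A\<^sub>y\<close>,
  \<open>A F1 = B\<^sub>y + A\<^sub>x\<close> and \<open>A F = B\<^sub>x\<close>. The first condition says \<open>ln \<bar>A\<bar> = h\<close> for a suitable \<open>g\<close>, and
  the stated identity is then \<open>B\<^sub>x\<^sub>y = B\<^sub>y\<^sub>x\<close> divided by \<open>A\<close>.

  Conversely, given \<open>g\<close>, put \<open>A = exp h\<close> and obtain \<open>B\<close> from the Poincare lemma. It remains to
  realize \<open>A\<close> and \<open>B\<close> by some \<open>\<psi>\<close> and \<open>\<phi> = \<psi>\<^sub>y/A\<close>, that is, to solve \<open>A \<psi>\<^sub>x = B \<psi>\<^sub>y\<close> with
  \<open>\<psi>\<^sub>y \<noteq> 0\<close>. As \<open>B/A\<close> is an arbitrary smooth function, this needs the smooth local flow of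
  \<open>y' = -B/A\<close>: \<open>\<psi>\<close> maps a point to the initial value at \<open>x0\<close> of the solution through it.
\<close>

section \<open>Functions with continuous partial derivatives\<close>

lemma open_prod_slices:
  assumes "open U" "(x, y) \<in> U"
  shows "\<forall>\<^sub>F s in nhds x. (s, y) \<in> U" "\<forall>\<^sub>F s in nhds y. (x, s) \<in> U"
proof -
  obtain A B where AB: "open A" "open B" "(x, y) \<in> A \<times> B" "A \<times> B \<subseteq> U"
    using open_prod_elim[OF assms] by blast
  show "\<forall>\<^sub>F s in nhds x. (s, y) \<in> U"
    using AB by (intro eventually_nhds[THEN iffD2] exI[of _ A]) auto
  show "\<forall>\<^sub>F s in nhds y. (x, s) \<in> U"
    using AB by (intro eventually_nhds[THEN iffD2] exI[of _ B]) auto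
qed

text \<open>An increment of \<open>f\<close> splits into a step in the first variable, handled by
  differentiability at the one point, and a step in the second, where continuity of
  \<open>fy\<close> gives a uniform estimate. The total derivative makes the chain rule available
  for functions described through partials.\<close>

lemma has_derivative_of_partials:
  fixes f :: "real \<Rightarrow> real \<Rightarrow> real"
  assumes U: "open U"
    and fx: "\<And>x y. (x, y) \<in> U \<Longrightarrow> ((\<lambda>s. f s y) has_real_derivative fx x y) (at x)"
    and fy: "\<And>x y. (x, y) \<in> U \<Longrightarrow> ((\<lambda>s. f x s) has_real_derivative fy x y) (at y)"
    and cont: "continuous_on U (\<lambda>(x, y). fy x y)"
    and p: "(x, y) \<in> U"
  shows "((\<lambda>(x, y). f x y) has_derivative (\<lambda>(u, v). fx x y * u + fy x y * v)) (at (x, y))"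
proof -
  obtain X Y where XY: "open X" "open Y" "x \<in> X" "y \<in> Y" "X \<times> Y \<subseteq> U"
    using open_prod_elim[OF U p] by (metis mem_Sigma_iff)
  \<comment> \<open>The mean value estimate in the second variable needs a convex factor, hence a
    ball inside \<open>Y\<close>.\<close>
  obtain e where e: "e > 0" "ball y e \<subseteq> Y"
    using XY by (meson open_contains_ball)
  let ?Y = "ball y e"
  have sub: "X \<times> ?Y \<subseteq> U" using XY e by blast
  have "((\<lambda>(x, y). f x y) has_derivative
      (\<lambda>(u, v). fx x y * u + blinfun_apply (blinfun_mult_right (fy x y)) v)) (at (x, y) within X \<times> ?Y)"
  proof (rule has_derivative_partialsI)
    show "((\<lambda>x. f x y) has_derivative (\<lambda>u. fx x y * u)) (at x within X)"
      using fx[OF p] by (simp add: has_field_derivative_def has_derivative_at_withinI)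
    show "((\<lambda>y. f x y) has_derivative blinfun_apply (blinfun_mult_right (fy x y))) (at y within ?Y)"
      if "x \<in> X" "y \<in> ?Y" for x y
    proof -
      have "(x, y) \<in> U" using that sub by blast
      from fy[OF this] show ?thesis
        by (simp add: has_field_derivative_def has_derivative_at_withinI)
    qed
    have "continuous_on (X \<times> ?Y) (\<lambda>q. blinfun_mult_right (case q of (x, y) \<Rightarrow> fy x y))"
      by (intro continuous_intros continuous_on_subset[OF cont sub])
    then show "continuous (at (x, y) within X \<times> ?Y) (\<lambda>(x, y). blinfun_mult_right (fy x y))"
      using XY e by (auto simp: continuous_on_eq_continuous_within case_prod_unfold)
  qed (use e in auto)
  moreover have "at (x, y) within X \<times> ?Y = at (x, y)"
    using XY e by (intro at_within_open open_Times) auto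
  ultimately show ?thesis by (simp add: mult.commute)
qed

lemma Ck_on_imp_continuous_on: "Ck_on k U f \<Longrightarrow> continuous_on U (\<lambda>(x, y). f x y)"
  by (cases k) auto

lemma Ck_on_Suc_partials:
  assumes "Ck_on (Suc k) U f" "(x, y) \<in> U"
  shows "((\<lambda>s. f s y) has_real_derivative partial_x f x y) (at x)"
    and "((\<lambda>s. f x s) has_real_derivative partial_y f x y) (at y)"
  using assms
  by (auto simp: partial_x_def partial_y_def DERIV_deriv_iff_real_differentiable)

lemma partial_x_eqI: "((\<lambda>s. f s y) has_real_derivative D) (at x) \<Longrightarrow> partial_x f x y = D"
  by (simp add: partial_x_def DERIV_imp_deriv)

lemma partial_y_eqI: "((\<lambda>s. f x s) has_real_derivative D) (at y) \<Longrightarrow> partial_y f x y = D"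
  by (simp add: partial_y_def DERIV_imp_deriv)

lemma Ck_on_subset: "Ck_on k U f \<Longrightarrow> V \<subseteq> U \<Longrightarrow> Ck_on k V f"
  by (induction k arbitrary: f) (auto intro: continuous_on_subset)

lemma partial_cong_open:
  assumes "open U" "(x, y) \<in> U" "\<And>x y. (x, y) \<in> U \<Longrightarrow> f x y = g x y"
  shows "partial_x f x y = partial_x g x y" "partial_y f x y = partial_y g x y"
proof -
  have "\<forall>\<^sub>F s in nhds x. f s y = g s y" "\<forall>\<^sub>F s in nhds y. f x s = g x s"
    by (rule eventually_mono[OF open_prod_slices(1)[OF assms(1,2)]], simp add: assms(3))
      (rule eventually_mono[OF open_prod_slices(2)[OF assms(1,2)]], simp add: assms(3))
  then show "partial_x f x y = partial_x g x y" "partial_y f x y = partial_y g x y"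
    unfolding partial_x_def partial_y_def by (simp_all add: deriv_cong_ev)
qed

text \<open>The value of \<open>deriv\<close> at a point depends only on nearby values. As
  \<open>U\<close> is open, agreement on \<open>U\<close> passes to all iterated partials.\<close>

lemma Ck_on_cong:
  assumes "open U" "Ck_on k U f" "\<And>x y. (x, y) \<in> U \<Longrightarrow> f x y = g x y"
  shows "Ck_on k U g"
  using assms(2,3)
proof (induction k arbitrary: f g)
  case 0
  then show ?case by (auto cong: continuous_on_cong simp: case_prod_unfold)
next
  case (Suc k)
  have "continuous_on U (\<lambda>(x, y). g x y)"
    using Suc.prems by (auto cong: continuous_on_cong simp: case_prod_unfold)
  moreover have "(\<lambda>s. g s y) differentiable (at x) \<and> (\<lambda>s. g x s) differentiable (at y)"
    if "(x, y) \<in> U" for x y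
  proof -
    have "((\<lambda>s. g s y) has_real_derivative partial_x f x y) (at x)"
      by (rule DERIV_cong_ev[THEN iffD1, OF refl _ refl Ck_on_Suc_partials(1)[OF Suc.prems(1) that]])
        (use open_prod_slices(1)[OF assms(1) that] in \<open>auto elim!: eventually_mono simp: Suc.prems(2)\<close>)
    moreover have "((\<lambda>s. g x s) has_real_derivative partial_y f x y) (at y)"
      by (rule DERIV_cong_ev[THEN iffD1, OF refl _ refl Ck_on_Suc_partials(2)[OF Suc.prems(1) that]])
        (use open_prod_slices(2)[OF assms(1) that] in \<open>auto elim!: eventually_mono simp: Suc.prems(2)\<close>)
    ultimately show ?thesis by (meson real_differentiable_def)
  qed
  moreover have "Ck_on k U (partial_x g)"
    using Suc.prems partial_cong_open(1)[OF assms(1), of _ _ f g]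
    by (auto intro: Suc.IH[of "partial_x f"])
  moreover have "Ck_on k U (partial_y g)"
    using Suc.prems partial_cong_open(2)[OF assms(1), of _ _ f g]
    by (auto intro: Suc.IH[of "partial_y f"])
  ultimately show ?case by auto
qed

text \<open>The working rule for raising the order of smoothness: explicit formulas
  \<open>fx\<close> and \<open>fy\<close> stand in for \<open>partial_x f\<close> and
  \<open>partial_y f\<close>, with which they agree on \<open>U\<close>. Continuity of
  \<open>f\<close> comes from total differentiability.\<close>

lemma Ck_on_SucI:
  assumes U: "open U"
    and fx: "\<And>x y. (x, y) \<in> U \<Longrightarrow> ((\<lambda>s. f s y) has_real_derivative fx x y) (at x)"
    and fy: "\<And>x y. (x, y) \<in> U \<Longrightarrow> ((\<lambda>s. f x s) has_real_derivative fy x y) (at y)"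
    and C: "Ck_on k U fx" "Ck_on k U fy"
  shows "Ck_on (Suc k) U f"
proof -
  have "continuous_on U (\<lambda>(x, y). f x y)"
  proof (intro continuous_at_imp_continuous_on ballI)
    fix p assume "p \<in> U"
    then show "isCont (\<lambda>(x, y). f x y) p"
      using has_derivative_continuous[OF has_derivative_of_partials[OF U fx fy
          Ck_on_imp_continuous_on[OF C(2)], of "fst p" "snd p"]] by auto
  qed
  moreover have "Ck_on k U (partial_x f)"
    by (rule Ck_on_cong[OF U C(1)]) (metis partial_x_eqI fx)
  moreover have "Ck_on k U (partial_y f)"
    by (rule Ck_on_cong[OF U C(2)]) (metis partial_y_eqI fy)
  moreover have "(\<lambda>s. f s y) differentiable (at x) \<and> (\<lambda>s. f x s) differentiable (at y)"
    if "(x, y) \<in> U" for x y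
    using fx[OF that] fy[OF that] by (meson real_differentiable_def)
  ultimately show ?thesis by (simp add: case_prod_unfold)
qed

lemma Ck_on_Suc_imp: "Ck_on (Suc k) U f \<Longrightarrow> Ck_on k U f"
proof (induction k arbitrary: f)
  case (Suc k)
  have "Ck_on (Suc k) U (partial_x f)" "Ck_on (Suc k) U (partial_y f)"
    using Suc.prems unfolding Ck_on.simps(2)[of "Suc k"] by blast+
  from this[THEN Suc.IH] show ?case
    using Suc.prems unfolding Ck_on.simps(2)[of "Suc k"] Ck_on.simps(2)[of k U f] by blast
qed simp

lemma Ck_on_Suc_has_derivative:
  assumes "open U" "Ck_on (Suc k) U f" "(x, y) \<in> U"
  shows "((\<lambda>(x, y). f x y) has_derivative (\<lambda>(u, v). partial_x f x y * u + partial_y f x y * v))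
    (at (x, y))"
proof -
  have "Ck_on k U (partial_y f)" using assms(2) by simp
  from has_derivative_of_partials[OF assms(1) Ck_on_Suc_partials[OF assms(2)]
      Ck_on_imp_continuous_on[OF this] assms(3)]
  show ?thesis .
qed

lemma Ck_on_chain:
  assumes "open V" "Ck_on (Suc k) V G" "(a z, b z) \<in> V"
    and "(a has_real_derivative a') (at z)" "(b has_real_derivative b') (at z)"
  shows "((\<lambda>s. G (a s) (b s)) has_real_derivative
    partial_x G (a z) (b z) * a' + partial_y G (a z) (b z) * b') (at z)"
proof -
  have "((\<lambda>s. (a s, b s)) has_derivative (\<lambda>u. (a' * u, b' * u))) (at z)"
    using assms(4,5) by (auto simp: has_field_derivative_def intro!: derivative_eq_intros)
  from has_derivative_compose[OF this Ck_on_Suc_has_derivative[OF assms(1-3)]]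
  have "((\<lambda>s. G (a s) (b s)) has_derivative
      (\<lambda>u. partial_x G (a z) (b z) * (a' * u) + partial_y G (a z) (b z) * (b' * u))) (at z)"
    by simp
  then show ?thesis
    by (rule has_derivative_imp_has_field_derivative) (simp add: algebra_simps)
qed

section \<open>Closure of the classes C^k under algebra, exponentials, inverses and
  composition\<close>

lemma Ck_on_const: "open U \<Longrightarrow> Ck_on k U (\<lambda>x y. c)"
proof (induction k arbitrary: c)
  case (Suc k)
  then show ?case
    by (intro Ck_on_SucI[where fx = "\<lambda>x y. 0" and fy = "\<lambda>x y. 0"]) auto
qed auto

lemma Ck_on_fst: "open U \<Longrightarrow> Ck_on k U (\<lambda>x y. x)"
proof (cases k)
  case (Suc n)
  assume U: "open U"
  show ?thesis unfolding Suc
    by (intro Ck_on_SucI[where fx = "\<lambda>x y. 1" and fy = "\<lambda>x y. 0"] Ck_on_const U) auto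
qed (simp add: case_prod_unfold continuous_on_fst continuous_on_snd)

lemma Ck_on_add:
  assumes "open U" shows "Ck_on k U f \<Longrightarrow> Ck_on k U g \<Longrightarrow> Ck_on k U (\<lambda>x y. f x y + g x y)"
proof (induction k arbitrary: f g)
  case (Suc k)
  note f = Ck_on_Suc_partials[OF Suc.prems(1)] and g = Ck_on_Suc_partials[OF Suc.prems(2)]
  have "Ck_on k U (partial_x f)" "Ck_on k U (partial_x g)" "Ck_on k U (partial_y f)" "Ck_on k U (partial_y g)"
    using Suc.prems by simp_all
  then show ?case
    by (intro Ck_on_SucI[OF assms DERIV_add[OF f(1) g(1)] DERIV_add[OF f(2) g(2)]] Suc.IH)
qed (simp add: case_prod_unfold continuous_on_add)

lemma Ck_on_mult:
  assumes "open U" shows "Ck_on k U f \<Longrightarrow> Ck_on k U g \<Longrightarrow> Ck_on k U (\<lambda>x y. f x y * g x y)"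
proof (induction k arbitrary: f g)
  case (Suc k)
  note f = Ck_on_Suc_partials[OF Suc.prems(1)] and g = Ck_on_Suc_partials[OF Suc.prems(2)]
  have "Ck_on k U (partial_x f)" "Ck_on k U (partial_x g)" "Ck_on k U (partial_y f)" "Ck_on k U (partial_y g)"
    using Suc.prems by simp_all
  moreover have "Ck_on k U f" "Ck_on k U g"
    by (fact Suc.prems[THEN Ck_on_Suc_imp])+
  ultimately show ?case
    by (intro Ck_on_SucI[OF assms DERIV_mult[OF f(1) g(1)] DERIV_mult[OF f(2) g(2)]] Suc.IH Ck_on_add[OF assms])
qed (simp add: case_prod_unfold continuous_on_mult)

lemma Ck_on_minus:
  assumes "open U" "Ck_on k U f" shows "Ck_on k U (\<lambda>x y. - f x y)"
  using Ck_on_mult[OF assms(1) Ck_on_const[OF assms(1), of k "-1"] assms(2)] by simp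

lemma Ck_on_diff:
  assumes "open U" "Ck_on k U f" "Ck_on k U g" shows "Ck_on k U (\<lambda>x y. f x y - g x y)"
  using Ck_on_add[OF assms(1,2) Ck_on_minus[OF assms(1,3)]] by simp

text \<open>A derivative of \<open>exp f\<close> is \<open>exp f\<close> times a derivative of
  \<open>f\<close>, so order \<open>k\<close> of \<open>exp f\<close> itself yields order
  \<open>Suc k\<close>. The same self-improvement serves for inverses, for the flow and for its
  inverse.\<close>

lemma Ck_on_exp:
  assumes "open U" shows "Ck_on k U f \<Longrightarrow> Ck_on k U (\<lambda>x y. exp (f x y))"
proof (induction k)
  case (Suc k)
  have "Ck_on k U f"
    by (fact Suc.prems[THEN Ck_on_Suc_imp])
  then have "Ck_on k U (\<lambda>x y. exp (f x y))" by (rule Suc.IH)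
  moreover have "Ck_on k U (partial_x f)" "Ck_on k U (partial_y f)"
    using Suc.prems by simp_all
  ultimately show ?case
    by (intro Ck_on_SucI[OF assms DERIV_fun_exp[OF Ck_on_Suc_partials(1)[OF Suc.prems]]
          DERIV_fun_exp[OF Ck_on_Suc_partials(2)[OF Suc.prems]]] Ck_on_mult[OF assms])
qed (simp add: case_prod_unfold continuous_on_exp)

lemma Ck_on_inverse:
  assumes "open U" and nz: "\<And>x y. (x, y) \<in> U \<Longrightarrow> f x y \<noteq> 0"
  shows "Ck_on k U f \<Longrightarrow> Ck_on k U (\<lambda>x y. inverse (f x y))"
proof (induction k)
  case (Suc k)
  have "Ck_on k U f"
    by (fact Suc.prems[THEN Ck_on_Suc_imp])
  then have "Ck_on k U (\<lambda>x y. inverse (f x y))" by (rule Suc.IH)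
  moreover have "Ck_on k U (partial_x f)" "Ck_on k U (partial_y f)"
    using Suc.prems by simp_all
  ultimately show ?case
    by (intro Ck_on_SucI[OF assms(1) DERIV_inverse'[OF Ck_on_Suc_partials(1)[OF Suc.prems] nz]
          DERIV_inverse'[OF Ck_on_Suc_partials(2)[OF Suc.prems] nz]] Ck_on_minus[OF assms(1)]
          Ck_on_mult[OF assms(1)])
qed (use nz in \<open>simp add: case_prod_unfold continuous_on_inverse\<close>)

lemma Ck_on_divide:
  assumes "open U" "\<And>x y. (x, y) \<in> U \<Longrightarrow> g x y \<noteq> 0" "Ck_on k U f" "Ck_on k U g"
  shows "Ck_on k U (\<lambda>x y. f x y / g x y)"
  unfolding divide_inverse using assms by (intro Ck_on_mult Ck_on_inverse)

text \<open>The induction ranges over all \<open>G\<close> with \<open>a\<close> and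
  \<open>b\<close> fixed, because the chain rule composes the partials of \<open>G\<close> with the
  same inner maps.\<close>

lemma Ck_on_compose:
  assumes "open U" "open V" and V: "\<And>x y. (x, y) \<in> U \<Longrightarrow> (a x y, b x y) \<in> V"
  shows "Ck_on k V G \<Longrightarrow> Ck_on k U a \<Longrightarrow> Ck_on k U b \<Longrightarrow> Ck_on k U (\<lambda>x y. G (a x y) (b x y))"
proof (induction k arbitrary: G)
  case 0
  have "continuous_on U (\<lambda>p. (\<lambda>(x, y). G x y) (a (fst p) (snd p), b (fst p) (snd p)))"
    by (rule continuous_on_compose2[where t = V and s = U])
      (use 0 V in \<open>auto simp: case_prod_unfold continuous_on_Pair\<close>)
  then show ?case by (simp add: case_prod_unfold)
next
  case (Suc k)
  have C: "Ck_on k U a" "Ck_on k U b"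
    by (fact Suc.prems(2,3)[THEN Ck_on_Suc_imp])+
  let ?D = "\<lambda>H x y. H (a x y) (b x y)"
  have "Ck_on k V (partial_x G)" "Ck_on k V (partial_y G)"
    using Suc.prems(1) by simp_all
  then have "Ck_on k U (?D (partial_x G))" "Ck_on k U (?D (partial_y G))"
    using C by (blast intro: Suc.IH)+
  moreover have "Ck_on k U (partial_x a)" "Ck_on k U (partial_x b)"
      "Ck_on k U (partial_y a)" "Ck_on k U (partial_y b)"
    using Suc.prems(2,3) by simp_all
  ultimately show ?case
    by (intro Ck_on_SucI[OF assms(1) Ck_on_chain[OF assms(2) Suc.prems(1) V
              Ck_on_Suc_partials(1)[OF Suc.prems(2)] Ck_on_Suc_partials(1)[OF Suc.prems(3)]]
            Ck_on_chain[OF assms(2) Suc.prems(1) V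
              Ck_on_Suc_partials(2)[OF Suc.prems(2)] Ck_on_Suc_partials(2)[OF Suc.prems(3)]]]
          Ck_on_add[OF assms(1)] Ck_on_mult[OF assms(1)])
qed

section \<open>Smooth functions of two variables and their relation to smooth functions of
  one\<close>

lemma smooth2_on_partials:
  assumes "smooth2_on U f"
  shows "smooth2_on U (partial_x f)" "smooth2_on U (partial_y f)"
  using assms unfolding smooth2_on_def by (metis Ck_on.simps(2))+

lemma smooth2_on_has_partials:
  assumes "smooth2_on U f" "(x, y) \<in> U"
  shows "((\<lambda>s. f s y) has_real_derivative partial_x f x y) (at x)"
    and "((\<lambda>s. f x s) has_real_derivative partial_y f x y) (at y)"
  using assms Ck_on_Suc_partials unfolding smooth2_on_def by blast+

lemma smooth2_on_continuous_on: "smooth2_on U f \<Longrightarrow> continuous_on U (\<lambda>(x, y). f x y)"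
  unfolding smooth2_on_def using Ck_on_imp_continuous_on by blast

lemma smooth2_on_subset: "smooth2_on U f \<Longrightarrow> V \<subseteq> U \<Longrightarrow> smooth2_on V f"
  unfolding smooth2_on_def using Ck_on_subset by blast

lemma smooth2_on_of_partials:
  assumes "open U"
    and "\<And>x y. (x, y) \<in> U \<Longrightarrow> ((\<lambda>s. f s y) has_real_derivative fx x y) (at x)"
    and "\<And>x y. (x, y) \<in> U \<Longrightarrow> ((\<lambda>s. f x s) has_real_derivative fy x y) (at y)"
    and "smooth2_on U fx" "smooth2_on U fy"
  shows "smooth2_on U f"
  using assms Ck_on_SucI[OF assms(1-3)] Ck_on_Suc_imp unfolding smooth2_on_def by blast

lemma smooth1_on_deriv: "smooth1_on I g \<Longrightarrow> smooth1_on I (deriv g)"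
  unfolding smooth1_on_def by (metis funpow_Suc_right o_apply)

lemma smooth1_on_has_derivative:
  "smooth1_on I g \<Longrightarrow> x \<in> I \<Longrightarrow> (g has_real_derivative deriv g x) (at x)"
  unfolding smooth1_on_def by (metis DERIV_deriv_iff_real_differentiable funpow_0)

lemma smooth1_on_imp_smooth2_on:
  assumes "open U" "\<And>x y. (x, y) \<in> U \<Longrightarrow> x \<in> I" "smooth1_on I g"
  shows "smooth2_on U (\<lambda>x y. g x)"
proof -
  have "Ck_on k U (\<lambda>x y. g x)" for k
    using assms(3)
  proof (induction k arbitrary: g)
    case 0
    have "continuous_on I g"
      using smooth1_on_has_derivative[OF 0] by (meson DERIV_atLeastAtMost_imp_continuous_on
          DERIV_isCont continuous_at_imp_continuous_on)
    then have "continuous_on U (\<lambda>p. g (fst p))"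
      by (rule continuous_on_compose2) (use assms(2) in \<open>auto simp: continuous_on_fst\<close>)
    then show ?case by (simp add: case_prod_unfold)
  next
    case (Suc k)
    show ?case
      by (rule Ck_on_SucI[OF assms(1), where fx = "\<lambda>x y. deriv g x" and fy = "\<lambda>x y. 0"])
        (auto intro!: smooth1_on_has_derivative[OF Suc.prems] Suc.IH smooth1_on_deriv Suc.prems
          Ck_on_const assms)
  qed
  then show ?thesis by (simp add: smooth2_on_def)
qed

text \<open>With \<open>y\<close> held fixed, \<open>deriv\<close> of the slice is
  \<open>partial_x\<close> by definition, even where no derivative exists; hence the iterates of
  both agree everywhere.\<close>

lemma smooth2_on_imp_smooth1_on:
  assumes "smooth2_on U f" "\<And>x. x \<in> I \<Longrightarrow> (x, y) \<in> U"
  shows "smooth1_on I (\<lambda>x. f x y)"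
proof -
  have sm: "smooth2_on U ((partial_x ^^ k) f)" for k
    by (induction k) (simp_all add: assms(1) smooth2_on_partials)
  have "(deriv ^^ k) (\<lambda>x. f x y) = (\<lambda>x. (partial_x ^^ k) f x y)" for k
    by (induction k) (simp_all add: partial_x_def[abs_def])
  then show ?thesis
    unfolding smooth1_on_def using smooth2_on_has_partials(1)[OF sm] assms(2)
    by (metis real_differentiable_def)
qed

section \<open>Primitives depending on a parameter\<close>

text \<open>
  The oriented integral of \<open>g\<close> from \<open>c\<close> to \<open>x\<close>, rescaled to the unit interval so that no case
  distinction on \<open>x < c\<close> arises and parameters enter through a fixed domain of integration.
\<close>

definition primitive :: "real \<Rightarrow> (real \<Rightarrow> real) \<Rightarrow> real \<Rightarrow> real" where
  "primitive c g x = (x - c) * integral {0..1} (\<lambda>t. g (c + t * (x - c)))"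

lemma convex_between:
  fixes c x t :: real
  assumes "convex I" "c \<in> I" "x \<in> I" "t \<in> {0..1}"
  shows "c + t * (x - c) \<in> I"
  using convexD_alt[OF assms(1-3), of t] assms(4) by (simp add: algebra_simps)

lemma primitive_cong:
  assumes "convex I" "c \<in> I" "x \<in> I" "\<And>t. t \<in> I \<Longrightarrow> g t = h t"
  shows "primitive c g x = primitive c h x"
  unfolding primitive_def
  by (intro arg_cong2[where f = "(*)"] refl integral_cong) (use convex_between[OF assms(1-3)] assms(4) in auto)

lemma primitive_self [simp]: "primitive c g c = 0"
  by (simp add: primitive_def)

lemma continuous_on_between:
  fixes g :: "real \<Rightarrow> real"
  assumes "convex I" "c \<in> I" "x \<in> I" "continuous_on I g"
  shows "continuous_on {0..1} (\<lambda>t. g (c + t * (x - c)))"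
  by (rule continuous_on_compose2[OF assms(4)])
    (use convex_between[OF assms(1-3)] in \<open>auto intro!: continuous_intros\<close>)

lemma primitive_bound:
  assumes "convex I" "c \<in> I" "x \<in> I" "continuous_on I g" "\<And>t. t \<in> I \<Longrightarrow> \<bar>g t\<bar> \<le> M"
  shows "\<bar>primitive c g x\<bar> \<le> \<bar>x - c\<bar> * M"
proof -
  have "norm (integral {0..1} (\<lambda>t. g (c + t * (x - c)))) \<le> M * (1 - 0)"
    by (rule integral_bound)
      (use continuous_on_between[OF assms(1-4)] convex_between[OF assms(1-3)] assms(5) in auto)
  then show ?thesis
    unfolding primitive_def abs_mult by (intro mult_left_mono) auto
qed

lemma primitive_diff:
  assumes "convex I" "c \<in> I" "x \<in> I" "continuous_on I g" "continuous_on I h"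
  shows "primitive c (\<lambda>t. g t - h t) x = primitive c g x - primitive c h x"
  unfolding primitive_def
  using continuous_on_between[OF assms(1-4)] continuous_on_between[OF assms(1-3,5)]
  by (simp add: integral_diff integrable_continuous_real right_diff_distrib)

text \<open>The fundamental theorem of calculus for \<open>G (c + t * (x - c))\<close> on the unit
  interval, valid for either order of \<open>c\<close> and \<open>x\<close>. Read backwards, it
  writes a difference of values as the increment times the mean of the derivative.\<close>

lemma primitive_eq_diff:
  assumes "convex I" "c \<in> I" "x \<in> I" "\<And>t. t \<in> I \<Longrightarrow> (G has_real_derivative g t) (at t)"
  shows "primitive c g x = G x - G c"
proof -
  have "((\<lambda>t. G (c + t * (x - c))) has_real_derivative g (c + t * (x - c)) * (x - c)) (at t)"
    if "t \<in> {0..1}" for t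
    by (rule DERIV_chain2[where f = G and g = "\<lambda>t. c + t * (x - c)"])
      (auto intro!: derivative_eq_intros assms(4) convex_between[OF assms(1-3)] that)
  then have "((\<lambda>t. g (c + t * (x - c)) * (x - c)) has_integral G (c + 1 * (x - c)) - G (c + 0 * (x - c))) {0..1}"
    by (intro fundamental_theorem_of_calculus)
      (auto simp flip: has_real_derivative_iff_has_vector_derivative intro: DERIV_subset)
  then show ?thesis
    unfolding primitive_def by (simp add: mult.commute integral_unique flip: integral_mult_right)
qed

lemma primitive_has_derivative:
  assumes x: "x \<in> {a<..<b}" and c: "c \<in> {a<..<b}" and g: "continuous_on {a<..<b} g"
  shows "(primitive c g has_real_derivative g x) (at x)"
proof -
  \<comment> \<open>These midpoints give a compact interval inside \<open>{a<..<b}\<close> with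
    \<open>c\<close> and \<open>x\<close> in its interior. There the primitive is a difference of
    two values of the ordinary integral from \<open>p\<close>.\<close>
  define p q where "p = (a + min c x) / 2" and "q = (b + max c x) / 2"
  have pq: "a < p" "q < b" "c \<in> {p<..<q}" "x \<in> {p<..<q}"
    using x c unfolding p_def q_def by auto
  have cont: "continuous_on {p..q} g"
    by (rule continuous_on_subset[OF g]) (use pq in auto)
  have D: "((\<lambda>u. integral {p..u} g) has_real_derivative g t) (at t)" if "t \<in> {p<..<q}" for t
  proof -
    have "((\<lambda>u. integral {p..u} g) has_real_derivative g t) (at t within {p..q})"
      using integral_has_real_derivative[OF cont, of t] that by simp
    then show ?thesis using that by (simp add: at_within_Icc_at)
  qed
  have "((\<lambda>u. integral {p..u} g - integral {p..c} g) has_real_derivative g x) (at x)"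
    using DERIV_diff[OF D[OF pq(4)] DERIV_const] by simp
  then show ?thesis
    by (rule has_field_derivative_transform_within_open[where S = "{p<..<q}"])
      (use pq primitive_eq_diff[where I = "{p<..<q}" and c = c, OF _ _ _ D] in auto)
qed

lemma continuous_on_primitive_param:
  assumes "convex I" "c \<in> I" and G: "continuous_on (I \<times> S) (\<lambda>(x, y). G x y)"
  shows "continuous_on (I \<times> S) (\<lambda>(x, y). primitive c (\<lambda>t. G t y) x)"
proof -
  have *: "continuous_on ((I \<times> S) \<times> cbox 0 1) (\<lambda>(p, t). G (c + t * (fst p - c)) (snd p))"
  proof -
    have "continuous_on ((I \<times> S) \<times> cbox 0 1)
      (\<lambda>q. (\<lambda>(x, y). G x y) (c + snd q * (fst (fst q) - c), snd (fst q)))"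
    proof (rule continuous_on_compose2[OF G])
      show "continuous_on ((I \<times> S) \<times> cbox 0 1) (\<lambda>q. (c + snd q * (fst (fst q) - c), snd (fst q)))"
        by (intro continuous_intros)
    qed (use convex_between[OF assms(1,2)] in auto)
    then show ?thesis by (simp add: case_prod_unfold)
  qed
  have "continuous_on (I \<times> S) (\<lambda>p. (fst p - c) * integral (cbox 0 1) (\<lambda>t. G (c + t * (fst p - c)) (snd p)))"
    by (intro continuous_intros integral_continuous_on_param *)
  then show ?thesis
    by (simp add: primitive_def case_prod_unfold)
qed

text \<open>Differentiation under the integral sign: after rescaling, the domain is the fixed
  interval [0,1], on which the parameter derivative of the integrand is jointly continuous.\<close>

lemma primitive_param_has_derivative:
  assumes I: "convex I" "c \<in> I" "x \<in> I" and J: "convex J" "open J" "y \<in> J"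
    and D: "\<And>x y. x \<in> I \<Longrightarrow> y \<in> J \<Longrightarrow> ((\<lambda>s. G x s) has_real_derivative Gy x y) (at y)"
    and C: "continuous_on (I \<times> J) (\<lambda>(x, y). G x y)" "continuous_on (I \<times> J) (\<lambda>(x, y). Gy x y)"
  shows "((\<lambda>s. primitive c (\<lambda>t. G t s) x) has_real_derivative primitive c (\<lambda>t. Gy t y) x) (at y)"
proof -
  have *: "continuous_on (J \<times> cbox 0 1) (\<lambda>(s, t). Gy (c + t * (x - c)) s)"
  proof -
    have "continuous_on (J \<times> cbox 0 1) (\<lambda>q. (\<lambda>(x, y). Gy x y) (c + snd q * (x - c), fst q))"
    proof (rule continuous_on_compose2[OF C(2)])
      show "continuous_on (J \<times> cbox 0 1) (\<lambda>q. (c + snd q * (x - c), fst q))"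
        by (intro continuous_intros)
    qed (use convex_between[OF I] in auto)
    then show ?thesis by (simp add: case_prod_unfold)
  qed
  have slice: "continuous_on I (\<lambda>t. G t s)" if "s \<in> J" for s
  proof -
    have "continuous_on I (\<lambda>t. (\<lambda>(x, y). G x y) (t, s))"
      by (rule continuous_on_compose2[OF C(1)]) (use that in \<open>auto intro!: continuous_intros\<close>)
    then show ?thesis by simp
  qed
  have "((\<lambda>s. integral (cbox 0 1) (\<lambda>t. G (c + t * (x - c)) s)) has_real_derivative
      integral (cbox 0 1) (\<lambda>t. Gy (c + t * (x - c)) y)) (at y within J)"
  proof (rule leibniz_rule_field_derivative[OF _ _ * J(3,1)])
    show "((\<lambda>s. G (c + t * (x - c)) s) has_real_derivative Gy (c + t * (x - c)) s) (at s within J)"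
      if "s \<in> J" "t \<in> cbox 0 1" for s t
      using D[OF convex_between[OF I, of t] that(1)] that(2) by (auto intro: DERIV_subset)
    show "(\<lambda>t. G (c + t * (x - c)) s) integrable_on cbox 0 1" if "s \<in> J" for s
      using continuous_on_between[OF I slice[OF that]] by (simp add: integrable_continuous_real)
  qed
  then have "((\<lambda>s. integral {0..1} (\<lambda>t. G (c + t * (x - c)) s)) has_real_derivative
      integral {0..1} (\<lambda>t. Gy (c + t * (x - c)) y)) (at y)"
    using at_within_open[OF J(3,2)] by simp
  then show ?thesis
    unfolding primitive_def by (rule DERIV_cmult)
qed

lemma continuous_on_slice_x:
  assumes "continuous_on (I \<times> J) (\<lambda>(x, y). G x y)" "y \<in> J"
  shows "continuous_on I (\<lambda>x. G x y)"
proof -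
  have "continuous_on I (\<lambda>t. (\<lambda>(x, y). G x y) (t, y))"
    by (rule continuous_on_compose2[OF assms(1)])
      (use assms(2) in \<open>auto intro!: continuous_on_Pair continuous_on_id continuous_on_const\<close>)
  then show ?thesis by simp
qed

text \<open>The two partials of the primitive are \<open>G\<close> itself and the primitive of
  \<open>partial_y G\<close>, so the induction has to range over all \<open>G\<close>.\<close>

lemma Ck_on_primitive:
  assumes "c \<in> {a<..<b}"
  shows "Ck_on k ({a<..<b} \<times> {p<..<q}) G \<Longrightarrow>
    Ck_on k ({a<..<b} \<times> {p<..<q}) (\<lambda>x y. primitive c (\<lambda>t. G t y) x)"
proof (induction k arbitrary: G)
  case 0
  then show ?case
    using continuous_on_primitive_param[of "{a<..<b}" c "{p<..<q}" G] assms by simp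
next
  case (Suc k)
  let ?U = "{a<..<b} \<times> {p<..<q}"
  have y: "Ck_on k ?U (partial_y G)" using Suc.prems by simp
  note cont = Ck_on_imp_continuous_on[OF Suc.prems] Ck_on_imp_continuous_on[OF y]
  show ?case
  proof (rule Ck_on_SucI[where fx = G])
    show "((\<lambda>s. primitive c (\<lambda>t. G t y) s) has_real_derivative G x y) (at x)" if "(x, y) \<in> ?U" for x y
      using primitive_has_derivative[of x a b c, OF _ assms continuous_on_slice_x[OF cont(1)]] that by auto
    show "((\<lambda>s. primitive c (\<lambda>t. G t s) x) has_real_derivative primitive c (\<lambda>t. partial_y G t y) x) (at y)"
      if "(x, y) \<in> ?U" for x y
      by (rule primitive_param_has_derivative[where I = "{a<..<b}" and J = "{p<..<q}", OF _ assms _ _ _ _ _ cont])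
        (use that in \<open>auto intro!: Ck_on_Suc_partials(2)[OF Suc.prems]\<close>)
  qed (auto intro!: Ck_on_Suc_imp[OF Suc.prems] Suc.IH y open_Times)
qed

section \<open>Local flows and the transport equation\<close>

text \<open>Picard iteration as a contraction with constant 1/2. It acts on functions of time and
  initial value together, so joint continuity of the flow comes with the fixed point.\<close>

lemma picard_flow:
  fixes f :: "real \<Rightarrow> real \<Rightarrow> real"
  assumes cont: "continuous_on UNIV (\<lambda>(x, y). f x y)"
    and M: "\<And>x y. \<bar>f x y\<bar> \<le> M"
    and L: "\<And>x y z. \<bar>f x y - f x z\<bar> \<le> L * \<bar>y - z\<bar>"
    and d: "0 < d" "d * L \<le> 1/2"
  obtains Y where "continuous_on UNIV (\<lambda>(x, s). Y x s)"
    and "\<And>x s. \<bar>x - c\<bar> \<le> d \<Longrightarrow> Y x s = s + primitive c (\<lambda>t. f t (Y t s)) x"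
proof -
  \<comment> \<open>Clamping time to the closed interval of radius \<open>d\<close> around
    \<open>c\<close> makes the iterates bounded on the whole plane and changes nothing on that
    interval.\<close>
  define cl where "cl x = max (c - d) (min (c + d) x)" for x
  have cl: "\<bar>cl x - c\<bar> \<le> d" "\<bar>x - c\<bar> \<le> d \<Longrightarrow> cl x = x" for x
    using d(1) unfolding cl_def by auto
  \<comment> \<open>The unknown is the displacement \<open>Z = Y - s\<close>: unlike
    \<open>Y\<close>, it is bounded and hence lies in the complete space of bounded continuous
    functions.\<close>
  define h where "h Z t s = f t (s + Z (t, s))" for Z :: "(real \<times> real) \<Rightarrow>\<^sub>C real" and t s
  have h: "continuous_on UNIV (\<lambda>(t, s). h Z t s)" for Z
  proof -
    have "continuous_on UNIV (\<lambda>p. (\<lambda>(x, y). f x y) (fst p, snd p + Z p))"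
      by (rule continuous_on_compose2[OF cont]) (auto intro!: continuous_intros)
    then show ?thesis by (simp add: h_def case_prod_unfold)
  qed
  have hs: "continuous_on UNIV (\<lambda>t. h Z t s)" for Z s
    using continuous_on_slice_x[of UNIV UNIV "h Z" s] h[of Z] by simp
  have L0: "0 \<le> L" using L[of 0 0 1] by (simp add: order_trans[OF abs_ge_zero])
  define T where "T Z p = primitive c (\<lambda>t. h Z t (snd p)) (cl (fst p))" for Z p
  have T: "T Z \<in> bcontfun" for Z
    unfolding bcontfun_def
  proof (intro CollectI conjI)
    have "continuous_on (UNIV \<times> UNIV) (\<lambda>(x, s). primitive c (\<lambda>t. h Z t s) x)"
      using continuous_on_primitive_param[of UNIV c UNIV "h Z"] h[of Z] by simp
    then have "continuous_on UNIV (\<lambda>p. (\<lambda>(x, s). primitive c (\<lambda>t. h Z t s) x) (cl (fst p), snd p))"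
      by (rule continuous_on_compose2) (auto simp: cl_def intro!: continuous_intros)
    then show "continuous_on UNIV (T Z)"
      by (simp add: T_def[abs_def])
    have "\<bar>T Z p\<bar> \<le> d * M" for p
    proof -
      have "\<bar>T Z p\<bar> \<le> \<bar>cl (fst p) - c\<bar> * M"
        unfolding T_def by (rule primitive_bound[where I = UNIV]) (auto simp: hs, simp add: h_def M)
      also have "\<dots> \<le> d * M"
        using M[of 0 0] by (intro mult_right_mono cl) auto
      finally show ?thesis .
    qed
    then show "bounded (range (T Z))"
      by (auto simp: bounded_iff)
  qed
  define P where "P Z = Bcontfun (T Z)" for Z
  have P: "apply_bcontfun (P Z) = T Z" for Z
    unfolding P_def by (rule Bcontfun_inverse[OF T])
  have "dist (P Z) (P W) \<le> 1/2 * dist Z W" for Z W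
  proof (rule dist_bound)
    fix p
    have "\<bar>T Z p - T W p\<bar> = \<bar>primitive c (\<lambda>t. h Z t (snd p) - h W t (snd p)) (cl (fst p))\<bar>"
      unfolding T_def by (subst primitive_diff[where I = UNIV]) (auto simp: hs)
    also have "\<dots> \<le> \<bar>cl (fst p) - c\<bar> * (L * dist Z W)"
    proof (rule primitive_bound[where I = UNIV])
      fix t
      have "\<bar>h Z t (snd p) - h W t (snd p)\<bar> \<le> L * \<bar>Z (t, snd p) - W (t, snd p)\<bar>"
        using L[of t "snd p + Z (t, snd p)" "snd p + W (t, snd p)"] by (simp add: h_def)
      also have "\<dots> \<le> L * dist Z W"
        using dist_bounded[of Z "(t, snd p)" W] by (intro mult_left_mono L0) (simp add: dist_real_def)
      finally show "\<bar>h Z t (snd p) - h W t (snd p)\<bar> \<le> L * dist Z W" .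
    qed (auto intro!: continuous_on_diff hs)
    also have "\<dots> \<le> d * (L * dist Z W)"
      using L0 by (intro mult_right_mono cl) auto
    also have "\<dots> \<le> 1/2 * dist Z W"
      using mult_right_mono[OF d(2), of "dist Z W"] by (simp add: mult.assoc)
    finally show "dist (P Z p) (P W p) \<le> 1/2 * dist Z W"
      by (simp add: P dist_real_def)
  qed
  then obtain Z where Z: "P Z = Z"
    using banach_fix_type[of "1/2" P] by auto
  show ?thesis
  proof (rule that[of "\<lambda>x s. s + Z (x, s)"])
    show "continuous_on UNIV (\<lambda>(x, s). s + Z (x, s))"
      by (simp add: case_prod_unfold continuous_on_add continuous_on_snd)
    fix x s assume "\<bar>x - c\<bar> \<le> d"
    then have "Z (x, s) = primitive c (\<lambda>t. f t (s + Z (t, s))) x"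
      using arg_cong[OF Z, of "\<lambda>W. apply_bcontfun W (x, s)"] by (simp add: P T_def h_def cl)
    then show "s + Z (x, s) = s + primitive c (\<lambda>t. f t (s + Z (t, s))) x" by simp
  qed
qed

text \<open>
  Hadamard's trick replaces Gronwall's inequality: the difference of two solutions satisfies the
  linear equation \<open>D' = N D\<close>, where \<open>N\<close> is the mean of \<open>fy\<close> over the segment between them, and is
  hence given by an explicit exponential which is continuous in the initial value.
\<close>

lemma flow_has_derivative_initial:
  fixes f fy Y :: "real \<Rightarrow> real \<Rightarrow> real"
  assumes x0: "x0 \<in> {a<..<b}"
    and fy: "\<And>x y. x \<in> {a<..<b} \<Longrightarrow> y \<in> J \<Longrightarrow> ((\<lambda>y. f x y) has_real_derivative fy x y) (at y)"
    and cfy: "continuous_on ({a<..<b} \<times> J) (\<lambda>(x, y). fy x y)"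
    and J: "convex J" and S: "open S"
    and Y: "continuous_on ({a<..<b} \<times> S) (\<lambda>(x, s). Y x s)"
    and Yx: "\<And>x s. x \<in> {a<..<b} \<Longrightarrow> s \<in> S \<Longrightarrow> ((\<lambda>x. Y x s) has_real_derivative f x (Y x s)) (at x)"
    and YJ: "\<And>x s. x \<in> {a<..<b} \<Longrightarrow> s \<in> S \<Longrightarrow> Y x s \<in> J"
    and init: "\<And>s. s \<in> S \<Longrightarrow> Y x0 s = s"
    and x: "x \<in> {a<..<b}" and s: "s \<in> S"
  shows "((\<lambda>s. Y x s) has_real_derivative exp (primitive x0 (\<lambda>t. fy t (Y t s)) x)) (at s)"
proof -
  let ?I = "{a<..<b}"
  define N where "N t r = integral {0..1} (\<lambda>u. fy t (Y t s + u * (Y t r - Y t s)))" for t r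
  have seg: "Y t s + u * (Y t r - Y t s) \<in> J" if "t \<in> ?I" "r \<in> S" "u \<in> {0..1}" for t r u
    by (rule convex_between[OF J YJ YJ]) (use that s in auto)
  have cY: "continuous_on T (\<lambda>z. Y (v z) (w z))"
    if "continuous_on T v" "continuous_on T w" "\<And>z. z \<in> T \<Longrightarrow> v z \<in> ?I \<and> w z \<in> S" for T v w
  proof -
    have "continuous_on T (\<lambda>z. (\<lambda>(x, s). Y x s) (v z, w z))"
      by (rule continuous_on_compose2[OF Y continuous_on_Pair[OF that(1,2)]]) (use that(3) in auto)
    then show ?thesis by simp
  qed
  have N: "continuous_on (?I \<times> S) (\<lambda>(t, r). N t r)"
  proof -
    have "continuous_on ((?I \<times> S) \<times> cbox 0 1)
        (\<lambda>q. (\<lambda>(x, y). fy x y) (fst (fst q), Y (fst (fst q)) s +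
           snd q * (Y (fst (fst q)) (snd (fst q)) - Y (fst (fst q)) s)))"
      by (rule continuous_on_compose2[OF cfy]) (use s seg in \<open>auto intro!: continuous_intros cY\<close>)
    then have *: "continuous_on ((?I \<times> S) \<times> cbox 0 1)
        (\<lambda>(p, u). fy (fst p) (Y (fst p) s + u * (Y (fst p) (snd p) - Y (fst p) s)))"
      by (simp add: case_prod_unfold)
    show ?thesis
      using integral_continuous_on_param[OF *] by (simp add: N_def case_prod_unfold)
  qed
  have fN: "f t (Y t r) - f t (Y t s) = (Y t r - Y t s) * N t r" if "t \<in> ?I" "r \<in> S" for t r
    using primitive_eq_diff[OF J YJ[OF that(1) s] YJ[OF that], of "f t" "fy t"] fy[OF that(1)]
    by (simp add: primitive_def N_def)
  have PN: "(primitive x0 (\<lambda>t. N t r) has_real_derivative N t r) (at t)" if "t \<in> ?I" "r \<in> S" for t r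
    by (rule primitive_has_derivative[OF that(1) x0 continuous_on_slice_x[OF N that(2)]])
  have growth: "Y x r - Y x s = (r - s) * exp (primitive x0 (\<lambda>t. N t r) x)" if r: "r \<in> S" for r
  proof -
    \<comment> \<open>The difference of two solutions divided by its expected growth factor. Its
      derivative vanishes, and its value at \<open>x0\<close> is \<open>r - s\<close>, which yields
      the explicit formula.\<close>
    define E where "E t = (Y t r - Y t s) * exp (- primitive x0 (\<lambda>t. N t r) t)" for t
    have "(E has_real_derivative 0) (at t)" if t: "t \<in> ?I" for t
    proof -
      have "(E has_real_derivative (f t (Y t r) - f t (Y t s)) * exp (- primitive x0 (\<lambda>t. N t r) t) +
          exp (- primitive x0 (\<lambda>t. N t r) t) * - N t r * (Y t r - Y t s)) (at t)"
        unfolding E_def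
        by (intro DERIV_mult DERIV_diff Yx DERIV_fun_exp DERIV_minus PN t r s)
      then show ?thesis by (simp add: fN[OF t r] algebra_simps)
    qed
    then have "E x = E x0"
      using has_field_derivative_zero_constant[of ?I E] x x0
      by (metis DERIV_subset convex_real_interval(8) subset_UNIV)
    then show ?thesis
      by (simp add: E_def init r s exp_minus field_simps)
  qed
  have lim: "((\<lambda>r. exp (primitive x0 (\<lambda>t. N t r) x)) \<longlongrightarrow> exp (primitive x0 (\<lambda>t. N t s) x)) (at s)"
  proof -
    have "continuous_on (?I \<times> S) (\<lambda>(x, r). primitive x0 (\<lambda>t. N t r) x)"
      by (rule continuous_on_primitive_param) (use x0 N in auto)
    then have "continuous_on S (\<lambda>r. (\<lambda>(x, r). primitive x0 (\<lambda>t. N t r) x) (x, r))"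
      by (rule continuous_on_compose2) (use x in \<open>auto intro!: continuous_intros\<close>)
    then have "isCont (\<lambda>r. primitive x0 (\<lambda>t. N t r) x) s"
      using S s by (simp add: continuous_on_eq_continuous_at)
    then show ?thesis by (intro tendsto_exp) (simp add: isCont_def)
  qed
  \<comment> \<open>For \<open>r = s\<close> the segment degenerates to a point and the mean
    \<open>N\<close> is the value of \<open>fy\<close> there.\<close>
  have Ns: "primitive x0 (\<lambda>t. N t s) x = primitive x0 (\<lambda>t. fy t (Y t s)) x"
    by (rule primitive_cong[where I = ?I]) (use x x0 in \<open>auto simp: N_def\<close>)
  show ?thesis
    unfolding has_field_derivative_iff
  proof (rule Lim_transform_within_open[OF lim[unfolded Ns] S s])
    fix r assume "r \<in> S" "r \<noteq> s"
    then show "exp (primitive x0 (\<lambda>t. N t r) x) = (Y x r - Y x s) / (r - s)"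
      by (simp add: growth)
  qed
qed

text \<open>Existence of the smooth flow of \<open>y' = f x y\<close>, with \<open>s\<close> as
  initial value at \<open>x0\<close>. The bound \<open>r / 4\<close> on the displacement and the
  positive derivative in \<open>s\<close> are what is needed to invert the flow in
  \<open>s\<close>.\<close>

lemma local_flow:
  fixes f :: "real \<Rightarrow> real \<Rightarrow> real"
  assumes f: "smooth2_on ({a<..<b} \<times> {c<..<d}) f" and x0: "x0 \<in> {a<..<b}" and y0: "y0 \<in> {c<..<d}"
  obtains \<delta> r Y where "0 < \<delta>" "0 < r"
    and "{x0-\<delta><..<x0+\<delta>} \<subseteq> {a<..<b}" "{y0-r<..<y0+r} \<subseteq> {c<..<d}"
    and "smooth2_on ({x0-\<delta><..<x0+\<delta>} \<times> {y0-r<..<y0+r}) Y"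
    and "\<And>x s. x \<in> {x0-\<delta><..<x0+\<delta>} \<Longrightarrow> s \<in> {y0-r<..<y0+r} \<Longrightarrow>
      Y x s \<in> {c<..<d} \<and> \<bar>Y x s - s\<bar> \<le> r / 4 \<and> partial_x Y x s = f x (Y x s) \<and> 0 < partial_y Y x s"
proof -
  obtain q where q: "0 < q" "{x0-q..x0+q} \<subseteq> {a<..<b}" "{y0-q..y0+q} \<subseteq> {c<..<d}"
  proof -
    \<comment> \<open>Half the distance to the boundary leaves a closed square inside the rectangle,
      where compactness bounds \<open>f\<close> and \<open>partial_y f\<close>.\<close>
    define m where "m = min (min (x0 - a) (b - x0)) (min (y0 - c) (d - y0))"
    have "0 < m" "m \<le> x0 - a" "m \<le> b - x0" "m \<le> y0 - c" "m \<le> d - y0"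
      using x0 y0 by (auto simp: m_def)
    then show ?thesis by (intro that[of "m / 2"]) auto
  qed
  let ?R = "{a<..<b} \<times> {c<..<d}" and ?K = "{x0-q..x0+q} \<times> {y0-q..y0+q}"
  have KR: "?K \<subseteq> ?R" using q by (intro Sigma_mono) auto
  have bounded: "\<exists>B>0. \<forall>x y. (x, y) \<in> ?K \<longrightarrow> \<bar>g x y\<bar> \<le> B" if "smooth2_on ?R g" for g
  proof -
    have "compact ((\<lambda>(x, y). g x y) ` ?K)"
      by (intro compact_continuous_image continuous_on_subset[OF smooth2_on_continuous_on[OF that] KR]
          compact_Times compact_Icc)
    from bounded_pos[THEN iffD1, OF compact_imp_bounded[OF this]] show ?thesis by force
  qed
  obtain M where M: "0 < M" "\<And>x y. (x, y) \<in> ?K \<Longrightarrow> \<bar>f x y\<bar> \<le> M"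
    using bounded[OF f] by blast
  obtain L where L: "0 < L" "\<And>x y. (x, y) \<in> ?K \<Longrightarrow> \<bar>partial_y f x y\<bar> \<le> L"
    using bounded[OF smooth2_on_partials(2)[OF f]] by blast
  have fy: "((\<lambda>y. f x y) has_real_derivative partial_y f x y) (at y)"
    if "x \<in> {a<..<b}" "y \<in> {c<..<d}" for x y
    using smooth2_on_has_partials(2)[OF f] that by blast
  have cfy: "continuous_on ?R (\<lambda>(x, y). partial_y f x y)"
    by (intro smooth2_on_continuous_on smooth2_on_partials f)
  have lip: "\<bar>f x y - f x z\<bar> \<le> L * \<bar>y - z\<bar>"
    if x: "x \<in> {x0-q..x0+q}" and y: "y \<in> {y0-q..y0+q}" and z: "z \<in> {y0-q..y0+q}" for x y z
  proof -
    have "continuous_on {y0-q..y0+q} (\<lambda>y. (\<lambda>(x, y). partial_y f x y) (x, y))"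
      by (rule continuous_on_compose2[OF continuous_on_subset[OF cfy KR]])
        (use x in \<open>auto intro!: continuous_intros\<close>)
    then have "\<bar>primitive z (partial_y f x) y\<bar> \<le> \<bar>y - z\<bar> * L"
      by (intro primitive_bound[where I = "{y0-q..y0+q}"]) (use L(2) x y z in auto)
    moreover have "primitive z (partial_y f x) y = f x y - f x z"
      by (rule primitive_eq_diff[where I = "{y0-q..y0+q}"]) (use x y z in \<open>auto intro!: fy q(2,3)[THEN subsetD]\<close>)
    ultimately show ?thesis by (simp add: mult.commute)
  qed
  \<comment> \<open>Clamping the arguments makes \<open>f\<close> globally bounded and Lipschitz without changing it near the point.\<close>
  define cl where "cl u v = max (u - q) (min (u + q) v)" for u v
  have cl: "cl u v \<in> {u-q..u+q}" "v \<in> {u-q..u+q} \<Longrightarrow> cl u v = v" "\<bar>cl u v - cl u w\<bar> \<le> \<bar>v - w\<bar>" for u v w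
    using q(1) unfolding cl_def by auto
  define g where "g x y = f (cl x0 x) (cl y0 y)" for x y
  have cg: "continuous_on UNIV (\<lambda>(x, y). g x y)"
  proof -
    have "continuous_on UNIV (\<lambda>p. (\<lambda>(x, y). f x y) (cl x0 (fst p), cl y0 (snd p)))"
      by (rule continuous_on_compose2[OF continuous_on_subset[OF smooth2_on_continuous_on[OF f] KR]])
        (use cl(1) in \<open>auto intro!: continuous_intros simp: cl_def[abs_def]\<close>)
    then show ?thesis by (simp add: g_def case_prod_unfold)
  qed
  have gM: "\<bar>g x y\<bar> \<le> M" for x y
    unfolding g_def by (rule M(2)) (use cl(1) in blast)
  have gL: "\<bar>g x y - g x z\<bar> \<le> L * \<bar>y - z\<bar>" for x y z
    using lip[OF cl(1) cl(1) cl(1), of x y z] mult_left_mono[OF cl(3)[of y0 y z], of L] L(1)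
    unfolding g_def by linarith
  \<comment> \<open>The three terms keep time inside the square, bound the displacement by
    \<open>q / 8\<close>, and give the contraction constant 1/2. With \<open>r = q / 2\<close> at
    the end, \<open>q / 8\<close> is \<open>r / 4\<close>.\<close>
  define \<delta> where "\<delta> = min q (min (q / (8 * M)) (1 / (2 * L)))"
  have \<delta>: "0 < \<delta>" "\<delta> \<le> q" "\<delta> * M \<le> q / 8" "\<delta> * L \<le> 1/2"
  proof -
    have "\<delta> \<le> q / (8 * M)" "\<delta> \<le> 1 / (2 * L)" unfolding \<delta>_def by auto
    then show "\<delta> * M \<le> q / 8" "\<delta> * L \<le> 1/2" using M(1) L(1) by (auto simp: field_simps)
  qed (use q(1) M(1) L(1) in \<open>auto simp: \<delta>_def\<close>)
  obtain Y where cY: "continuous_on UNIV (\<lambda>(x, s). Y x s)"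
    and Y: "\<And>x s. \<bar>x - x0\<bar> \<le> \<delta> \<Longrightarrow> Y x s = s + primitive x0 (\<lambda>t. g t (Y t s)) x"
    using picard_flow[where c = x0, OF cg gM gL \<delta>(1,4)] by blast
  let ?I = "{x0-\<delta><..<x0+\<delta>}" and ?S = "{y0-q/2<..<y0+q/2}"
  have IS: "?I \<subseteq> {a<..<b}" "?S \<subseteq> {c<..<d}"
  proof -
    have "?I \<subseteq> {x0-q..x0+q}" "?S \<subseteq> {y0-q..y0+q}" using \<delta> q(1) by auto
    then show "?I \<subseteq> {a<..<b}" "?S \<subseteq> {c<..<d}" using q(2,3) by blast+
  qed
  have cgY: "continuous_on UNIV (\<lambda>t. g t (Y t s))" for s
  proof -
    have "continuous_on UNIV (\<lambda>t. Y t s)"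
      using continuous_on_slice_x[of UNIV UNIV Y s] cY by simp
    then have "continuous_on UNIV (\<lambda>t. (\<lambda>(x, y). g x y) (t, Y t s))"
      by (intro continuous_on_compose2[OF cg] continuous_on_Pair continuous_on_id) auto
    then show ?thesis by simp
  qed
  have close: "\<bar>Y x s - s\<bar> \<le> q / 8" if "x \<in> ?I" for x s
  proof -
    have "\<bar>Y x s - s\<bar> \<le> \<bar>x - x0\<bar> * M"
      using Y[of x s] that primitive_bound[of UNIV x0 x "\<lambda>t. g t (Y t s)" M] cgY gM by auto
    also have "\<dots> \<le> \<delta> * M"
      using that M(1) by (intro mult_right_mono) auto
    finally show ?thesis using \<delta>(3) by simp
  qed
  \<comment> \<open>An initial value within \<open>q / 2\<close> of \<open>y0\<close> moves by at
    most \<open>q / 8\<close>, so the solution stays in the square, where the clamped field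
    \<open>g\<close> equals \<open>f\<close>.\<close>
  have Yin: "Y x s \<in> {y0-q..y0+q}" if "x \<in> ?I" "s \<in> ?S" for x s
  proof -
    have "y0 - q/2 < s" "s < y0 + q/2" using that(2) by auto
    with close[OF that(1), of s] show ?thesis by (simp only: atLeastAtMost_iff) linarith
  qed
  then have Yin': "Y x s \<in> {c<..<d}" if "x \<in> ?I" "s \<in> ?S" for x s
    using that q(3) by blast
  have gf: "g x (Y x s) = f x (Y x s)" if "x \<in> ?I" "s \<in> ?S" for x s
    using cl(2)[of x x0] cl(2)[OF Yin[OF that]] that(1) \<delta>(2) by (auto simp: g_def)
  have Yx: "((\<lambda>x. Y x s) has_real_derivative f x (Y x s)) (at x)" if xs: "x \<in> ?I" "s \<in> ?S" for x s
  proof (rule has_field_derivative_transform_within_open[where S = ?I])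
    have "(primitive x0 (\<lambda>t. g t (Y t s)) has_real_derivative f x (Y x s)) (at x)"
      using primitive_has_derivative[OF xs(1), of x0 "\<lambda>t. g t (Y t s)"] \<delta>(1)
        continuous_on_subset[OF cgY] gf[OF xs] by simp
    from DERIV_add[OF DERIV_const[of s] this]
    show "((\<lambda>x. s + primitive x0 (\<lambda>t. g t (Y t s)) x) has_real_derivative f x (Y x s)) (at x)" by simp
    show "s + primitive x0 (\<lambda>t. g t (Y t s)) x = Y x s" if "x \<in> ?I" for x
      using that by (intro Y[symmetric]) auto
  qed (use xs in auto)
  have init: "Y x0 s = s" for s
    using Y[of x0 s] \<delta>(1) by simp
  have Ys: "((\<lambda>s. Y x s) has_real_derivative exp (primitive x0 (\<lambda>t. partial_y f t (Y t s)) x)) (at s)"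
    if "x \<in> ?I" "s \<in> ?S" for x s
  proof (rule flow_has_derivative_initial[where f = f and fy = "partial_y f" and J = "{c<..<d}" and S = ?S])
    show "continuous_on (?I \<times> {c<..<d}) (\<lambda>(x, y). partial_y f x y)"
      using IS(1) by (intro continuous_on_subset[OF cfy]) auto
  qed (use that IS \<delta>(1) Yx Yin' fy init in \<open>auto intro: continuous_on_subset[OF cY]\<close>)
  have W: "open (?I \<times> ?S)" by (intro open_Times) auto
  \<comment> \<open>Both partial derivatives of \<open>Y\<close> are as smooth as \<open>Y\<close> itself, so each step gains one order.\<close>
  have "Ck_on k (?I \<times> ?S) Y" for k
  proof (induction k)
    case 0
    show ?case using continuous_on_subset[OF cY] by simp
  next
    case (Suc k)
    have *: "Ck_on k (?I \<times> ?S) (\<lambda>x s. h x (Y x s))" if "smooth2_on ?R h" for h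
      by (rule Ck_on_compose[OF W, where V = ?R])
        (use that Yin' IS Suc in \<open>auto simp: smooth2_on_def open_Times Ck_on_fst[OF W]\<close>)
    show ?case
      using Yx Ys \<delta>(1)
      by (intro Ck_on_SucI[OF W, where fx = "\<lambda>x s. f x (Y x s)" and
            fy = "\<lambda>x s. exp (primitive x0 (\<lambda>t. partial_y f t (Y t s)) x)"]
          * f Ck_on_exp[OF W] Ck_on_primitive smooth2_on_partials) auto
  qed
  then have "smooth2_on (?I \<times> ?S) Y" by (simp add: smooth2_on_def)
  then show ?thesis
    using close Yin' q(1)
    by (intro that[of \<delta> "q / 2" Y] \<delta>(1) IS)
      (auto simp: partial_x_eqI[of Y, OF Yx] partial_y_eqI[of Y, OF Ys])
qed

section \<open>Inverting the flow: solution of the transport equation\<close>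

lemma strict_increasing_of_partial_y:
  assumes "convex S" "\<And>s. s \<in> S \<Longrightarrow> (g has_real_derivative g' s) (at s)" "\<And>s. s \<in> S \<Longrightarrow> 0 < g' s"
    and "s \<in> S" "t \<in> S" "s < t"
  shows "g s < (g t :: real)"
proof (rule DERIV_pos_imp_increasing[OF assms(6)])
  fix x assume "s \<le> x" "x \<le> t"
  then have "x \<in> S" using assms(1,4,5) by (meson convex_contains_segment is_interval_convex_1 mem_is_interval_1_I)
  then show "\<exists>y. (g has_real_derivative y) (at x) \<and> 0 < y" using assms(2,3) by blast
qed

text \<open>\<open>\<psi>\<close> is a first integral of \<open>y' = f x y\<close>: differentiating
  \<open>\<psi> x (Y x s) = s\<close> in \<open>x\<close> gives the transport equation, and
  differentiating in \<open>s\<close> gives the sign of \<open>partial_y \<psi>\<close>.\<close>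

lemma transport_equation_solution:
  fixes f :: "real \<Rightarrow> real \<Rightarrow> real"
  assumes f: "smooth2_on ({a<..<b} \<times> {c<..<d}) f" and x0: "x0 \<in> {a<..<b}" and y0: "y0 \<in> {c<..<d}"
  obtains I J \<psi> where "open_rectangle_around x0 y0 I J" "I \<subseteq> {a<..<b}" "J \<subseteq> {c<..<d}"
    and "smooth2_on (I \<times> J) \<psi>"
    and "\<And>x y. x \<in> I \<Longrightarrow> y \<in> J \<Longrightarrow> 0 < partial_y \<psi> x y"
    and "\<And>x y. x \<in> I \<Longrightarrow> y \<in> J \<Longrightarrow> partial_x \<psi> x y = - f x y * partial_y \<psi> x y"
proof -
  obtain \<delta> r Y where \<delta>: "0 < \<delta>" and r: "0 < r"
    and sub: "{x0-\<delta><..<x0+\<delta>} \<subseteq> {a<..<b}" "{y0-r<..<y0+r} \<subseteq> {c<..<d}"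
    and Y: "smooth2_on ({x0-\<delta><..<x0+\<delta>} \<times> {y0-r<..<y0+r}) Y"
    and YP: "\<And>x s. x \<in> {x0-\<delta><..<x0+\<delta>} \<Longrightarrow> s \<in> {y0-r<..<y0+r} \<Longrightarrow>
      Y x s \<in> {c<..<d} \<and> \<bar>Y x s - s\<bar> \<le> r / 4 \<and> partial_x Y x s = f x (Y x s) \<and> 0 < partial_y Y x s"
    using local_flow[OF f x0 y0] by metis
  let ?I = "{x0-\<delta><..<x0+\<delta>}" and ?S = "{y0-r<..<y0+r}" and ?J = "{y0-r/4<..<y0+r/4}"
  let ?W = "?I \<times> ?S"
  have W: "open ?W" and IJ: "open (?I \<times> ?J)" by (intro open_Times; simp)+
  have Ys: "((\<lambda>s. Y x s) has_real_derivative partial_y Y x s) (at s)" if "x \<in> ?I" "s \<in> ?S" for x s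
    using smooth2_on_has_partials(2)[OF Y] that by blast
  have mono: "Y x s < Y x t" if "x \<in> ?I" "s \<in> ?S" "t \<in> ?S" "s < t" for x s t
    using YP that(1) by (intro strict_increasing_of_partial_y[where S = ?S, OF _ Ys _ that(2-4)]) auto
  have inj: "s = t" if "x \<in> ?I" "s \<in> ?S" "t \<in> ?S" "Y x s = Y x t" for x s t
    using mono[OF that(1,2,3)] mono[OF that(1,3,2)] that(4) by force
  \<comment> \<open>At \<open>s = y0 - r/2\<close> and \<open>s = y0 + r/2\<close> a displacement of
    at most \<open>r / 4\<close> leaves the values of the flow on opposite sides of
    \<open>?J\<close>; the intermediate value theorem does the rest. This fixes the size of
    \<open>?J\<close>.\<close>
  have surj: "\<exists>s\<in>?S. Y x s = y" if "x \<in> ?I" "y \<in> ?J" for x y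
  proof -
    have "\<bar>Y x (y0 - r/2) - (y0 - r/2)\<bar> \<le> r / 4" "\<bar>Y x (y0 + r/2) - (y0 + r/2)\<bar> \<le> r / 4"
      using YP[OF that(1), of "y0 - r/2"] YP[OF that(1), of "y0 + r/2"] r by auto
    moreover have "y0 - r/4 < y" "y < y0 + r/4" using that(2) by auto
    ultimately have "Y x (y0 - r/2) \<le> y" "y \<le> Y x (y0 + r/2)" by linarith+
    then have "\<exists>s\<ge>y0 - r/2. s \<le> y0 + r/2 \<and> Y x s = y"
      using r by (intro IVT) (auto intro!: DERIV_isCont[OF Ys[OF that(1)]])
    then show ?thesis using r by auto
  qed
  define \<psi> where "\<psi> x y = (SOME s. s \<in> ?S \<and> Y x s = y)" for x y
  have \<psi>: "\<psi> x y \<in> ?S" "Y x (\<psi> x y) = y" if "x \<in> ?I" "y \<in> ?J" for x y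
    using someI_ex[of "\<lambda>s. s \<in> ?S \<and> Y x s = y"] surj[OF that] unfolding \<psi>_def by blast+
  have \<psi>Y: "\<psi> x (Y x s) = s" if "x \<in> ?I" "s \<in> ?S" for x s
    using someI_ex[of "\<lambda>t. t \<in> ?S \<and> Y x t = Y x s"] inj[OF that(1)] that(2) unfolding \<psi>_def by blast
  \<comment> \<open>The inverse function theorem for the map from \<open>(x, s)\<close> to
    \<open>(x, Y x s)\<close>, whose Jacobian is triangular with nonzero diagonal. It gives
    differentiability of \<open>\<psi>\<close> without a prior proof of continuity.\<close>
  have D: "((\<lambda>(x, y). (x, \<psi> x y)) has_derivative
      (\<lambda>(u, v). (u, (v - f x y * u) / partial_y Y x (\<psi> x y)))) (at (x, y))"
    if xy: "x \<in> ?I" "y \<in> ?J" for x y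
  proof (rule has_derivative_inverse_strong_x[where S = ?W and f = "\<lambda>(x, s). (x, Y x s)"
        and f' = "\<lambda>(u, v). (u, f x y * u + partial_y Y x (\<psi> x y) * v)"])
    have "((\<lambda>(x, s). Y x s) has_derivative (\<lambda>(u, v). f x y * u + partial_y Y x (\<psi> x y) * v)) (at (x, \<psi> x y))"
      using Ck_on_Suc_has_derivative[OF W, of 0 Y x "\<psi> x y"] Y YP[OF xy(1) \<psi>(1)[OF xy]] \<psi>[OF xy] xy
      by (simp add: smooth2_on_def del: Ck_on.simps)
    from has_derivative_Pair[OF has_derivative_fst[OF has_derivative_ident] this]
    show "((\<lambda>(x, s). (x, Y x s)) has_derivative (\<lambda>(u, v). (u, f x y * u + partial_y Y x (\<psi> x y) * v)))
        (at (case (x, y) of (x, y) \<Rightarrow> (x, \<psi> x y)))"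
      by (simp add: case_prod_unfold)
    show "continuous_on ?W (\<lambda>(x, s). (x, Y x s))"
      using smooth2_on_continuous_on[OF Y]
      by (auto simp: case_prod_unfold intro!: continuous_on_Pair continuous_on_fst continuous_on_id)
    show "(\<lambda>(u, v). (u, f x y * u + partial_y Y x (\<psi> x y) * v)) \<circ>
        (\<lambda>(u, v). (u, (v - f x y * u) / partial_y Y x (\<psi> x y))) = id"
      using YP[OF xy(1) \<psi>(1)[OF xy]] by (auto simp: fun_eq_iff)
  qed (use xy \<psi> \<psi>Y W in auto)
  have \<psi>': "((\<lambda>(x, y). \<psi> x y) has_derivative (\<lambda>(u, v). (v - f x y * u) / partial_y Y x (\<psi> x y))) (at (x, y))"
    if "x \<in> ?I" "y \<in> ?J" for x y
    using has_derivative_snd[OF D[OF that]] by (simp add: case_prod_unfold)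
  have \<psi>x: "((\<lambda>x. \<psi> x y) has_real_derivative - f x y * inverse (partial_y Y x (\<psi> x y))) (at x)"
    if "x \<in> ?I" "y \<in> ?J" for x y
  proof -
    have "((\<lambda>x. \<psi> x y) has_derivative (\<lambda>u. (0 - f x y * u) / partial_y Y x (\<psi> x y))) (at x)"
      using has_derivative_compose[where s = UNIV, OF has_derivative_Pair[OF has_derivative_ident has_derivative_const[of y]] \<psi>'[OF that]]
      by simp
    then show ?thesis
      by (rule has_derivative_imp_has_field_derivative) (simp add: divide_inverse algebra_simps)
  qed
  have \<psi>y: "((\<lambda>y. \<psi> x y) has_real_derivative inverse (partial_y Y x (\<psi> x y))) (at y)"
    if "x \<in> ?I" "y \<in> ?J" for x y
  proof -
    have "((\<lambda>y. \<psi> x y) has_derivative (\<lambda>u. (u - f x y * 0) / partial_y Y x (\<psi> x y))) (at y)"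
      using has_derivative_compose[where s = UNIV, OF has_derivative_Pair[OF has_derivative_const[of x] has_derivative_ident] \<psi>'[OF that]]
      by simp
    then show ?thesis
      by (rule has_derivative_imp_has_field_derivative) (simp add: divide_inverse algebra_simps)
  qed
  \<comment> \<open>The formulas for both partials contain \<open>\<psi>\<close> only inside the
    smooth function \<open>partial_y Y\<close>, so every order of \<open>\<psi>\<close> produces the
    next one.\<close>
  have "Ck_on k (?I \<times> ?J) \<psi>" for k
  proof (induction k)
    case 0
    have "isCont (\<lambda>(x, y). \<psi> x y) p" if "p \<in> ?I \<times> ?J" for p
      using that has_derivative_continuous[OF \<psi>', of "fst p" "snd p"] by (auto simp: mem_Times_iff)
    then show ?case by (simp add: continuous_at_imp_continuous_on)
  next
    case (Suc k)
    have "Ck_on k (?I \<times> ?J) (\<lambda>x y. partial_y Y x (\<psi> x y))"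
      by (rule Ck_on_compose[OF IJ W])
        (use \<psi> Suc smooth2_on_partials(2)[OF Y] in \<open>auto simp: smooth2_on_def Ck_on_fst[OF IJ]\<close>)
    moreover have "partial_y Y x (\<psi> x y) \<noteq> 0" if "(x, y) \<in> ?I \<times> ?J" for x y
      using YP[of x "\<psi> x y"] \<psi>(1)[of x y] that by auto
    ultimately have inv: "Ck_on k (?I \<times> ?J) (\<lambda>x y. inverse (partial_y Y x (\<psi> x y)))"
      by (intro Ck_on_inverse[OF IJ])
    have "?I \<times> ?J \<subseteq> {a<..<b} \<times> {c<..<d}" using sub r by fastforce
    then have "Ck_on k (?I \<times> ?J) f" using f by (auto simp: smooth2_on_def intro: Ck_on_subset)
    then show ?case
      by (intro Ck_on_SucI[OF IJ \<psi>x \<psi>y] Ck_on_mult[OF IJ] Ck_on_minus[OF IJ] inv) auto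
  qed
  then have "smooth2_on (?I \<times> ?J) \<psi>" by (simp add: smooth2_on_def)
  moreover have "0 < partial_y \<psi> x y" "partial_x \<psi> x y = - f x y * partial_y \<psi> x y"
    if "x \<in> ?I" "y \<in> ?J" for x y
    using YP[OF that(1) \<psi>(1)[OF that]]
    by (simp_all add: partial_x_eqI[of \<psi>, OF \<psi>x[OF that]] partial_y_eqI[of \<psi>, OF \<psi>y[OF that]])
  moreover have "open_rectangle_around x0 y0 ?I ?J"
    unfolding open_rectangle_around_def using \<delta> r by (intro exI conjI) (rule refl, auto)
  moreover have "?J \<subseteq> {c<..<d}" using sub r by fastforce
  ultimately show ?thesis using sub(1) by (intro that[of ?I ?J \<psi>]) auto
qed

section \<open>Sundman transformations\<close>

lemma inj_on_of_nonzero_derivative: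
  fixes T :: "real \<Rightarrow> real"
  assumes T: "\<And>x. x \<in> {p<..<q} \<Longrightarrow> (T has_real_derivative T' x) (at x)"
    and nz: "\<And>x. x \<in> {p<..<q} \<Longrightarrow> T' x \<noteq> 0"
  shows "inj_on T {p<..<q}"
proof -
  have "T s \<noteq> T t" if st: "s \<in> {p<..<q}" "t \<in> {p<..<q}" "s < t" for s t
  proof
    assume "T s = T t"
    moreover have "\<exists>z. s < z \<and> z < t \<and> T t - T s = (t - s) * T' z"
      by (rule MVT2[OF st(3) T]) (use st in auto)
    ultimately obtain z where "s < z" "z < t" "T' z = 0" using st(3) by auto
    with nz[of z] st show False by auto
  qed
  then show ?thesis by (metis inj_onI linorder_neqE_linordered_idom)
qed

text \<open>The rule d/dt = (1/T') d/dx. Since \<open>T\<close> is continuous and injective,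
  invariance of domain makes the image of the interval open; the inverse of \<open>T\<close> is
  differentiable there, and \<open>u\<close> equals \<open>W\<close> composed with it.\<close>

lemma has_derivative_change_of_parameter:
  fixes T u W :: "real \<Rightarrow> real"
  assumes T: "\<And>x. x \<in> {p<..<q} \<Longrightarrow> (T has_real_derivative T' x) (at x)"
    and nz: "\<And>x. x \<in> {p<..<q} \<Longrightarrow> T' x \<noteq> 0"
    and u: "\<And>x. x \<in> {p<..<q} \<Longrightarrow> u (T x) = W x"
    and W: "(W has_real_derivative w) (at x)" and x: "x \<in> {p<..<q}"
  shows "(u has_real_derivative w / T' x) (at (T x))"
proof -
  let ?I = "{p<..<q}"
  note inj = inj_on_of_nonzero_derivative[OF T nz]
  define g where "g = inv_into ?I T"
  have g: "g (T z) = z" if "z \<in> ?I" for z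
    unfolding g_def by (rule inv_into_f_f[OF inj that])
  have cont: "continuous_on ?I T"
    by (intro continuous_at_imp_continuous_on ballI DERIV_isCont[OF T])
  have op: "open (T ` ?I)"
    by (rule invariance_of_domain[OF cont _ inj]) simp
  have "(g has_derivative (\<lambda>v. v / T' x)) (at (T x))"
    by (rule has_derivative_inverse_strong[OF _ x cont g T[OF x, unfolded has_field_derivative_def]])
      (use nz[OF x] in \<open>auto simp: fun_eq_iff\<close>)
  then have g': "(g has_real_derivative 1 / T' x) (at (T x))"
    by (rule has_derivative_imp_has_field_derivative) simp
  have "((\<lambda>t. W (g t)) has_real_derivative w * (1 / T' x)) (at (T x))"
    by (rule DERIV_chain2[OF _ g']) (simp only: g[OF x] W)
  then have "(u has_real_derivative w * (1 / T' x)) (at (T x))"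
    by (rule has_field_derivative_transform_within_open[OF _ op]) (use x g u in auto)
  then show ?thesis by simp
qed

lemma DERIV_along_curve:
  assumes "open R" "smooth2_on R G" "(s, y s) \<in> R" "(y has_real_derivative y') (at s)"
  shows "((\<lambda>s. G s (y s)) has_real_derivative partial_x G s (y s) + partial_y G s (y s) * y') (at s)"
  using Ck_on_chain[OF assms(1), of 0 G "\<lambda>s. s" s y 1 y'] assms
  by (simp add: smooth2_on_def del: Ck_on.simps)

text \<open>One change of parameter gives \<open>B + A y'\<close> for the first derivative of
  \<open>u\<close>; a second one divides the total derivative of this expression by
  \<open>\<phi>\<close>.\<close>

lemma sundman_second_derivative:
  assumes R: "open R" and S: "sundman_transformation R \<psi> \<phi>"
    and A: "smooth2_on R A" "\<And>x y. (x, y) \<in> R \<Longrightarrow> partial_y \<psi> x y = A x y * \<phi> x y"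
    and B: "smooth2_on R B" "\<And>x y. (x, y) \<in> R \<Longrightarrow> partial_x \<psi> x y = B x y * \<phi> x y"
    and y: "smooth1_on {p<..<q} y" "\<And>x. x \<in> {p<..<q} \<Longrightarrow> (x, y x) \<in> R"
    and im: "sundman_image \<psi> \<phi> {p<..<q} y T u" and x: "x \<in> {p<..<q}"
  shows "deriv (deriv u) (T x) =
    (A x (y x) * deriv (deriv y) x + partial_y A x (y x) * (deriv y x)\<^sup>2
      + (partial_y B x (y x) + partial_x A x (y x)) * deriv y x + partial_x B x (y x)) / \<phi> x (y x)"
proof -
  let ?I = "{p<..<q}"
  have \<psi>: "smooth2_on R \<psi>" and nz: "\<phi> x (y x) \<noteq> 0" if "x \<in> ?I" for x
    using S y(2)[OF that] unfolding sundman_transformation_def by auto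
  have T: "(T has_real_derivative \<phi> x (y x)) (at x)" and u: "u (T x) = \<psi> x (y x)" if "x \<in> ?I" for x
    using im that unfolding sundman_image_def by auto
  have y1: "(y has_real_derivative deriv y x) (at x)" if "x \<in> ?I" for x
    using y(1) that by (rule smooth1_on_has_derivative)
  have y2: "(deriv y has_real_derivative deriv (deriv y) x) (at x)"
    using smooth1_on_deriv[OF y(1)] x by (rule smooth1_on_has_derivative)
  \<comment> \<open>Needed on the whole interval and not only at the given point, because it is
    differentiated again.\<close>
  have du: "deriv u (T x) = B x (y x) + A x (y x) * deriv y x" if "x \<in> ?I" for x
  proof -
    have "(u has_real_derivative (partial_x \<psi> x (y x) + partial_y \<psi> x (y x) * deriv y x) / \<phi> x (y x)) (at (T x))"
      by (rule has_derivative_change_of_parameter[OF T nz u DERIV_along_curve[OF R \<psi> y(2) y1]])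
        (use that in auto)
    moreover have "partial_x \<psi> x (y x) + partial_y \<psi> x (y x) * deriv y x
        = (B x (y x) + A x (y x) * deriv y x) * \<phi> x (y x)"
      unfolding A(2)[OF y(2)[OF that]] B(2)[OF y(2)[OF that]] by (simp add: algebra_simps)
    ultimately show ?thesis
      using nz[OF that] by (simp add: DERIV_imp_deriv)
  qed
  have "((\<lambda>x. B x (y x) + A x (y x) * deriv y x) has_real_derivative
      (partial_x B x (y x) + partial_y B x (y x) * deriv y x) +
      ((partial_x A x (y x) + partial_y A x (y x) * deriv y x) * deriv y x
        + deriv (deriv y) x * A x (y x))) (at x)"
    by (intro DERIV_add DERIV_mult DERIV_along_curve[OF R] A B y(2) y1 y2 x)
  from has_derivative_change_of_parameter[OF T nz du this x]
  show ?thesis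
    by (simp add: DERIV_imp_deriv algebra_simps power2_eq_square)
qed

text \<open>The three conditions compare coefficients of polynomials in y'. The two equations are
  only known to have the same solutions, so for necessity the value of y'' forced by the given
  equation is substituted into the formula for the second derivative of \<open>u\<close>.\<close>

lemma transforms_to_free_particle_iff:
  assumes R: "open R" and S: "sundman_transformation R \<psi> \<phi>"
    and A: "smooth2_on R A" "\<And>x y. (x, y) \<in> R \<Longrightarrow> partial_y \<psi> x y = A x y * \<phi> x y"
    and B: "smooth2_on R B" "\<And>x y. (x, y) \<in> R \<Longrightarrow> partial_x \<psi> x y = B x y * \<phi> x y"
  shows "transforms_to_free_particle R F2 F1 F \<psi> \<phi> \<longleftrightarrow>
    (\<forall>(x, y)\<in>R. A x y * F2 x y = partial_y A x y \<and>
       A x y * F1 x y = partial_y B x y + partial_x A x y \<and> A x y * F x y = partial_x B x y)"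
    (is "_ \<longleftrightarrow> ?C")
proof
  have nz: "\<phi> x y \<noteq> 0" "A x y \<noteq> 0" if "(x, y) \<in> R" for x y
    using S A(2)[OF that] that unfolding sundman_transformation_def by auto
  have \<phi>: "continuous_on R (\<lambda>(x, y). \<phi> x y)"
    using S unfolding sundman_transformation_def by (blast intro: smooth2_on_continuous_on)
  {
    assume C: ?C
    show "transforms_to_free_particle R F2 F1 F \<psi> \<phi>"
      unfolding transforms_to_free_particle_def
    proof (intro allI impI ballI, elim conjE)
      fix p q y T u x
      assume y: "smooth1_on {p<..<q} y" "\<forall>x\<in>{p<..<q}. (x, y x) \<in> R"
        and im: "sundman_image \<psi> \<phi> {p<..<q} y T u" and x: "x \<in> {p<..<q}"
      have xR: "(x, y x) \<in> R" using x y(2) by blast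
      have c: "partial_y A x (y x) = A x (y x) * F2 x (y x)"
        "partial_y B x (y x) + partial_x A x (y x) = A x (y x) * F1 x (y x)"
        "partial_x B x (y x) = A x (y x) * F x (y x)"
        using C xR by auto
      \<comment> \<open>Under the conditions the second derivative of \<open>u\<close> is the
        left-hand side of the equation times the nonvanishing factor
        \<open>A / \<phi>\<close>.\<close>
      have "deriv (deriv u) (T x) = A x (y x) * (deriv (deriv y) x + F2 x (y x) * (deriv y x)\<^sup>2
          + F1 x (y x) * deriv y x + F x (y x)) / \<phi> x (y x)"
        using sundman_second_derivative[OF R S A B y(1) _ im x] y(2)
        unfolding c by (simp add: algebra_simps)
      then show "satisfies_ode_at F2 F1 F y x \<longleftrightarrow> deriv (deriv u) (T x) = 0"
        using nz[OF xR] by (simp add: satisfies_ode_at_def)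
    qed
  }
  assume tr: "transforms_to_free_particle R F2 F1 F \<psi> \<phi>"
  have key: "A x y * (F2 x y * v\<^sup>2 + F1 x y * v + F x y) =
      partial_y A x y * v\<^sup>2 + (partial_y B x y + partial_x A x y) * v + partial_x B x y"
    if xy: "(x, y) \<in> R" for x y v
  proof -
    \<comment> \<open>\<open>w\<close> is the second derivative that the equation prescribes at
      \<open>(x, y)\<close> for slope \<open>v\<close>; the parabola \<open>c\<close> has exactly
      this 2-jet and hence satisfies the equation at \<open>x\<close>.\<close>
    define w where "w = - (F2 x y * v\<^sup>2 + F1 x y * v + F x y)"
    define c where "c s = y + v * (s - x) + w / 2 * ((s - x) * (s - x))" for s
    \<comment> \<open>Regarding \<open>c\<close> as a function of two variables lets the closure
      rules for C^k prove its smoothness.\<close>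
    have "smooth2_on UNIV (\<lambda>s t. c s)"
      unfolding smooth2_on_def c_def
      by (intro allI Ck_on_add Ck_on_mult Ck_on_diff Ck_on_const Ck_on_fst open_UNIV)
    then have c: "smooth1_on I c" for I
      by (rule smooth2_on_imp_smooth1_on) simp
    have dc: "deriv c = (\<lambda>s. v + w * (s - x))"
      unfolding c_def by (intro ext DERIV_imp_deriv) (auto intro!: derivative_eq_intros)
    have ddc: "deriv (deriv c) x = w"
      unfolding dc by (rule DERIV_imp_deriv) (auto intro!: derivative_eq_intros)
    have cc: "continuous_on UNIV (\<lambda>s. (s, c s))"
      unfolding c_def by (intro continuous_intros)
    have "open ((\<lambda>s. (s, c s)) -` R)"
      using R cc by (simp add: continuous_on_open_vimage)
    moreover have cx: "c x = y" by (simp add: c_def)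
    then have "x \<in> (\<lambda>s. (s, c s)) -` R" using xy by simp
    ultimately obtain e where e: "0 < e" "ball x e \<subseteq> (\<lambda>s. (s, c s)) -` R"
      by (rule openE)
    let ?I = "{x-e<..<x+e}"
    have cR: "(s, c s) \<in> R" if "s \<in> ?I" for s
      using e(2) that by (auto simp: ball_eq_greaterThanLessThan)
    have xI: "x \<in> ?I" using e(1) by simp
    define T where "T = primitive x (\<lambda>s. \<phi> s (c s))"
    have T: "(T has_real_derivative \<phi> s (c s)) (at s)" if "s \<in> ?I" for s
      unfolding T_def
    proof (rule primitive_has_derivative[OF that xI])
      have "continuous_on ?I (\<lambda>s. (\<lambda>(x, y). \<phi> x y) (s, c s))"
        by (rule continuous_on_compose2[OF \<phi> continuous_on_subset[OF cc]]) (use cR in auto)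
      then show "continuous_on ?I (\<lambda>s. \<phi> s (c s))" by simp
    qed
    have inj: "inj_on T ?I"
      by (rule inj_on_of_nonzero_derivative[OF T]) (use nz(1) cR in auto)
    \<comment> \<open>As \<open>T\<close> is injective on \<open>?I\<close>, its inverse turns
      \<open>\<psi>\<close> along the parabola into a function of the new time.\<close>
    define u where "u t = \<psi> (inv_into ?I T t) (c (inv_into ?I T t))" for t
    have im: "sundman_image \<psi> \<phi> ?I c T u"
      unfolding sundman_image_def u_def using T inv_into_f_f[OF inj] by auto
    have "satisfies_ode_at F2 F1 F c x"
      unfolding satisfies_ode_at_def ddc cx by (simp add: dc w_def)
    then have "deriv (deriv u) (T x) = 0"
      using tr c[of ?I] cR im xI unfolding transforms_to_free_particle_def by blast
    then have "A x y * w + partial_y A x y * v\<^sup>2 + (partial_y B x y + partial_x A x y) * v + partial_x B x y = 0"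
      using sundman_second_derivative[OF R S A B c[of ?I] cR im xI] nz(1)[OF xy]
      unfolding ddc cx by (simp add: dc)
    then show ?thesis by (simp add: w_def algebra_simps)
  qed
  show ?C
  proof (clarify, intro conjI)
    fix x y assume xy: "(x, y) \<in> R"
    \<comment> \<open>Three values of \<open>v\<close> determine the coefficients of a quadratic
      polynomial.\<close>
    note k = key[OF xy, of 0] key[OF xy, of 1] key[OF xy, of "-1"]
    show "A x y * F2 x y = partial_y A x y" "A x y * F1 x y = partial_y B x y + partial_x A x y"
      "A x y * F x y = partial_x B x y"
      using k by (simp_all add: algebra_simps)
  qed
qed

section \<open>Mixed partials, the Poincare lemma on a rectangle, and the logarithm of a
  nonvanishing function\<close>

text \<open>Write \<open>f z y\<close> as \<open>f x y\<close> plus the integral of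
  \<open>partial_x f\<close> from \<open>x\<close> to \<open>z\<close>. Differentiating under the
  integral in \<open>y\<close> and then in \<open>z\<close> at \<open>x\<close> leaves the integrand
  \<open>partial_y (partial_x f)\<close>.\<close>

lemma mixed_partials:
  assumes f: "smooth2_on ({a<..<b} \<times> {c<..<d}) f" and xy: "x \<in> {a<..<b}" "y \<in> {c<..<d}"
  shows "partial_x (partial_y f) x y = partial_y (partial_x f) x y"
proof (rule partial_x_eqI, rule has_field_derivative_transform_within_open[where S = "{a<..<b}"])
  let ?R = "{a<..<b} \<times> {c<..<d}"
  note fx = smooth2_on_partials(1)[OF f] and fxy = smooth2_on_partials(2)[OF smooth2_on_partials(1)[OF f]]
  have "(primitive x (\<lambda>t. partial_y (partial_x f) t y) has_real_derivative partial_y (partial_x f) x y) (at x)"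
    by (rule primitive_has_derivative[OF xy(1,1) continuous_on_slice_x[OF smooth2_on_continuous_on[OF fxy] xy(2)]])
  then show "((\<lambda>z. partial_y f x y + primitive x (\<lambda>t. partial_y (partial_x f) t y) z)
      has_real_derivative partial_y (partial_x f) x y) (at x)"
    using DERIV_add[OF DERIV_const] by fastforce
  fix z assume z: "z \<in> {a<..<b}"
  have "((\<lambda>s. primitive x (\<lambda>t. partial_x f t s) z) has_real_derivative
      primitive x (\<lambda>t. partial_y (partial_x f) t y) z) (at y)"
    by (rule primitive_param_has_derivative[OF _ xy(1) z _ _ xy(2) _
          smooth2_on_continuous_on[OF fx] smooth2_on_continuous_on[OF fxy]])
      (auto intro!: smooth2_on_has_partials(2)[OF fx])
  from DERIV_add[OF smooth2_on_has_partials(2)[OF f, of x y] this]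
  have D: "((\<lambda>s. f x s + primitive x (\<lambda>t. partial_x f t s) z) has_real_derivative
      partial_y f x y + primitive x (\<lambda>t. partial_y (partial_x f) t y) z) (at y)"
    using xy by simp
  moreover have "f x s + primitive x (\<lambda>t. partial_x f t s) z = f z s" if "s \<in> {c<..<d}" for s
    using primitive_eq_diff[of "{a<..<b}" x z "\<lambda>t. f t s" "\<lambda>t. partial_x f t s"]
      smooth2_on_has_partials(1)[OF f] xy(1) z that by auto
  ultimately have "((\<lambda>s. f z s) has_real_derivative
      partial_y f x y + primitive x (\<lambda>t. partial_y (partial_x f) t y) z) (at y)"
    by (intro has_field_derivative_transform_within_open[where S = "{c<..<d}", OF D])
      (use xy(2) in auto)
  then show "partial_y f x y + primitive x (\<lambda>t. partial_y (partial_x f) t y) z = partial_y f z y"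
    by (simp add: partial_y_eqI)
qed (use xy in auto)

text \<open>\<open>B\<close> integrates the closed form G dx + E dy from \<open>(x0, y0)\<close>
  along an L-shaped path: first vertically on the line through \<open>x0\<close>, then
  horizontally.\<close>

lemma poincare_rectangle:
  assumes G: "smooth2_on ({a<..<b} \<times> {c<..<d}) G" and E: "smooth2_on ({a<..<b} \<times> {c<..<d}) E"
    and closed: "\<And>x y. x \<in> {a<..<b} \<Longrightarrow> y \<in> {c<..<d} \<Longrightarrow> partial_y G x y = partial_x E x y"
    and x0: "x0 \<in> {a<..<b}" and y0: "y0 \<in> {c<..<d}"
  obtains B where "smooth2_on ({a<..<b} \<times> {c<..<d}) B"
    and "\<And>x y. x \<in> {a<..<b} \<Longrightarrow> y \<in> {c<..<d} \<Longrightarrow> partial_x B x y = G x y"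
    and "\<And>x y. x \<in> {a<..<b} \<Longrightarrow> y \<in> {c<..<d} \<Longrightarrow> partial_y B x y = E x y"
proof -
  let ?I = "{a<..<b}" and ?J = "{c<..<d}"
  define B where "B x y = primitive x0 (\<lambda>t. G t y) x + primitive y0 (E x0) y" for x y
  note Gy = smooth2_on_partials(2)[OF G]
  have Ex0: "continuous_on ?J (E x0)"
  proof -
    have "continuous_on ?J (\<lambda>s. (\<lambda>(x, y). E x y) (x0, s))"
      by (rule continuous_on_compose2[OF smooth2_on_continuous_on[OF E]])
        (use x0 in \<open>auto intro!: continuous_intros\<close>)
    then show ?thesis by simp
  qed
  have Bx: "((\<lambda>x. B x y) has_real_derivative G x y) (at x)" if "x \<in> ?I" "y \<in> ?J" for x y
    using DERIV_add[OF primitive_has_derivative[OF that(1) x0 continuous_on_slice_x[OF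
          smooth2_on_continuous_on[OF G] that(2)]] DERIV_const]
    unfolding B_def by simp
  have By: "((\<lambda>y. B x y) has_real_derivative E x y) (at y)" if xy: "x \<in> ?I" "y \<in> ?J" for x y
  proof -
    have "((\<lambda>y. primitive x0 (\<lambda>t. G t y) x) has_real_derivative primitive x0 (\<lambda>t. partial_y G t y) x) (at y)"
      by (rule primitive_param_has_derivative[OF _ x0 xy(1) _ _ xy(2) _
            smooth2_on_continuous_on[OF G] smooth2_on_continuous_on[OF Gy]])
        (auto intro!: smooth2_on_has_partials(2)[OF G])
    \<comment> \<open>Closedness replaces \<open>partial_y G\<close> by \<open>partial_x E\<close>,
      which integrates to a difference; the vertical leg of the path supplies the missing
      \<open>E x0 y\<close>.\<close>
    moreover have "primitive x0 (\<lambda>t. partial_y G t y) x = E x y - E x0 y"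
      by (rule primitive_eq_diff[where I = ?I and G = "\<lambda>t. E t y"])
        (use x0 xy closed smooth2_on_has_partials(1)[OF E] in auto)
    ultimately show ?thesis
      using DERIV_add[OF _ primitive_has_derivative[OF xy(2) y0 Ex0]] unfolding B_def by force
  qed
  show ?thesis
  proof
    show "smooth2_on (?I \<times> ?J) B"
      by (rule smooth2_on_of_partials[OF _ Bx By G E]) (auto intro!: open_Times)
  qed (simp_all add: partial_x_eqI[OF Bx] partial_y_eqI[OF By])
qed

text \<open>\<open>ln ((A x y)\<^sup>2) / 2\<close> is the logarithm of the absolute value of
  \<open>A\<close>, written so that the sign of \<open>A\<close> need not be known.\<close>

lemma smooth2_on_ln_square:
  assumes "open U" "smooth2_on U A" "\<And>x y. (x, y) \<in> U \<Longrightarrow> A x y \<noteq> 0"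
  shows "smooth2_on U (\<lambda>x y. ln ((A x y)\<^sup>2) / 2)"
    and "\<And>x y. (x, y) \<in> U \<Longrightarrow>
      ((\<lambda>s. ln ((A s y)\<^sup>2) / 2) has_real_derivative partial_x A x y / A x y) (at x)"
    and "\<And>x y. (x, y) \<in> U \<Longrightarrow>
      ((\<lambda>s. ln ((A x s)\<^sup>2) / 2) has_real_derivative partial_y A x y / A x y) (at y)"
proof -
  show x: "((\<lambda>s. ln ((A s y)\<^sup>2) / 2) has_real_derivative partial_x A x y / A x y) (at x)"
    if "(x, y) \<in> U" for x y
    using assms(3)[OF that] zero_less_power2[of "A x y"]
    by (auto intro!: derivative_eq_intros smooth2_on_has_partials(1)[OF assms(2) that]
        simp: power2_eq_square zero_less_mult_iff not_less)
  show y: "((\<lambda>s. ln ((A x s)\<^sup>2) / 2) has_real_derivative partial_y A x y / A x y) (at y)"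
    if "(x, y) \<in> U" for x y
    using assms(3)[OF that] zero_less_power2[of "A x y"]
    by (auto intro!: derivative_eq_intros smooth2_on_has_partials(2)[OF assms(2) that]
        simp: power2_eq_square zero_less_mult_iff not_less)
  have "Ck_on k U (\<lambda>x y. partial_x A x y / A x y)" "Ck_on k U (\<lambda>x y. partial_y A x y / A x y)" for k
    using smooth2_on_partials[OF assms(2)] assms(2,3)
    by (auto intro!: Ck_on_divide[OF assms(1)] simp: smooth2_on_def)
  then show "smooth2_on U (\<lambda>x y. ln ((A x y)\<^sup>2) / 2)"
    by (intro smooth2_on_of_partials[OF assms(1) x y]) (auto simp: smooth2_on_def)
qed

section \<open>The criterion for S-linearizability\<close>

theorem theorem2p1:
  fixes F2 F1 F H :: "real \<Rightarrow> real \<Rightarrow> real" and U :: "(real \<times> real) set" and x0 y0 :: real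
  assumes "open U" and "(x0, y0) \<in> U"
    and "smooth2_on U F2" and "smooth2_on U F1" and "smooth2_on U F"
    and "smooth2_on U H"
    and "\<And>x y. (x, y) \<in> U \<Longrightarrow> ((\<lambda>s. H x s) has_real_derivative F2 x y) (at y)"
  shows "S_linearizable_at U F2 F1 F x0 y0 \<longleftrightarrow>
    (\<exists>I J g. open_rectangle_around x0 y0 I J \<and> I \<times> J \<subseteq> U \<and> smooth1_on I g \<and>
      (let h = (\<lambda>x y. H x y + g x) in
        \<forall>x\<in>I. \<forall>y\<in>J.
          partial_x F1 x y + F1 x y * partial_x h x y - (partial_x h x y)\<^sup>2
            - partial_x (partial_x h) x y - partial_y F x y - F x y * F2 x y = 0))"
    (is "_ \<longleftrightarrow> ?R")
proof
  assume "S_linearizable_at U F2 F1 F x0 y0"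
  then obtain I J \<psi> \<phi> where rect: "open_rectangle_around x0 y0 I J" and IJU: "I \<times> J \<subseteq> U"
    and S: "sundman_transformation (I \<times> J) \<psi> \<phi>"
    and tr: "transforms_to_free_particle (I \<times> J) F2 F1 F \<psi> \<phi>"
    unfolding S_linearizable_at_def by blast
  from rect obtain a b c d where ab: "I = {a<..<b}" and cd: "J = {c<..<d}"
    and x0: "x0 \<in> I" and y0: "y0 \<in> J"
    unfolding open_rectangle_around_def by blast
  have op: "open (I \<times> J)" unfolding ab cd by (intro open_Times) auto
  have \<psi>: "smooth2_on (I \<times> J) \<psi>" and \<phi>: "smooth2_on (I \<times> J) \<phi>"
    and nz: "\<And>x y. (x, y) \<in> I \<times> J \<Longrightarrow> partial_y \<psi> x y * \<phi> x y \<noteq> 0"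
    using S unfolding sundman_transformation_def by auto
  define A where "A x y = partial_y \<psi> x y / \<phi> x y" for x y
  define B where "B x y = partial_x \<psi> x y / \<phi> x y" for x y
  have A0: "A x y \<noteq> 0" if "(x, y) \<in> I \<times> J" for x y
    using nz[OF that] by (simp add: A_def)
  have A: "smooth2_on (I \<times> J) A" and B: "smooth2_on (I \<times> J) B"
    using \<phi> smooth2_on_partials[OF \<psi>] nz unfolding smooth2_on_def A_def B_def
    by (fastforce intro!: Ck_on_divide[OF op])+
  have cond: "F2 x y = partial_y A x y / A x y"
      "F1 x y = (partial_y B x y + partial_x A x y) / A x y" "F x y = partial_x B x y / A x y"
    if "(x, y) \<in> I \<times> J" for x y
  proof -
    have "\<forall>(x, y)\<in>I \<times> J. A x y * F2 x y = partial_y A x y \<and>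
       A x y * F1 x y = partial_y B x y + partial_x A x y \<and> A x y * F x y = partial_x B x y"
      using tr by (rule transforms_to_free_particle_iff[OF op S A _ B, THEN iffD1, rotated -1])
        (use nz in \<open>auto simp: A_def B_def\<close>)
    then show "F2 x y = partial_y A x y / A x y"
      "F1 x y = (partial_y B x y + partial_x A x y) / A x y" "F x y = partial_x B x y / A x y"
      using that A0[OF that] by (auto simp: field_simps)
  qed
  note Ax = smooth2_on_has_partials(1)[OF A] and Ay = smooth2_on_has_partials(2)[OF A]
  have ln: "smooth2_on (I \<times> J) (\<lambda>x y. ln ((A x y)\<^sup>2) / 2)"
    by (rule smooth2_on_ln_square(1)[OF op A A0])
  have lnx: "((\<lambda>s. ln ((A s y)\<^sup>2) / 2) has_real_derivative partial_x A x y / A x y) (at x)"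
    and lny: "((\<lambda>s. ln ((A x s)\<^sup>2) / 2) has_real_derivative partial_y A x y / A x y) (at y)"
    if "(x, y) \<in> I \<times> J" for x y
    by (rule smooth2_on_ln_square(2)[OF op A A0 that], assumption)
      (rule smooth2_on_ln_square(3)[OF op A A0 that], assumption)
  \<comment> \<open>\<open>ln \<bar>A\<bar>\<close> and \<open>H\<close> have the same y-derivative
    \<open>F2\<close>, so their difference depends on \<open>x\<close> alone and may be evaluated at
    \<open>y0\<close>. Thus \<open>h\<close> becomes \<open>ln \<bar>A\<bar>\<close>.\<close>
  define g where "g x = ln ((A x y0)\<^sup>2) / 2 - H x y0" for x
  define h where "h x y = H x y + g x" for x y
  have g: "smooth1_on I g"
  proof -
    have "smooth2_on (I \<times> J) (\<lambda>x y. ln ((A x y)\<^sup>2) / 2 - H x y)"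
      using ln smooth2_on_subset[OF assms(6) IJU] Ck_on_diff[OF op] unfolding smooth2_on_def
      by simp
    from smooth2_on_imp_smooth1_on[OF this, of I y0] show ?thesis
      using y0 by (simp add: g_def[abs_def])
  qed
  have h: "h x y = ln ((A x y)\<^sup>2) / 2" if x: "x \<in> I" and y: "y \<in> J" for x y
  proof -
    have "((\<lambda>s. ln ((A x s)\<^sup>2) / 2 - H x s) has_real_derivative 0) (at s)" if "s \<in> J" for s
    proof -
      have xs: "(x, s) \<in> I \<times> J" using x that by simp
      then have "(x, s) \<in> U" using IJU by blast
      from DERIV_diff[OF lny[OF xs] assms(7)[OF this]] show ?thesis
        by (simp add: cond(1)[OF xs])
    qed
    then have "\<exists>k. \<forall>s\<in>J. ln ((A x s)\<^sup>2) / 2 - H x s = k"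
      by (intro has_field_derivative_zero_constant) (simp_all add: cd has_field_derivative_at_within)
    then have "ln ((A x y)\<^sup>2) / 2 - H x y = ln ((A x y0)\<^sup>2) / 2 - H x y0"
      using y y0 by metis
    then show ?thesis by (simp add: h_def g_def)
  qed
  have hx: "partial_x h x y = partial_x A x y / A x y" if "(x, y) \<in> I \<times> J" for x y
    using partial_cong_open(1)[OF op that, of h "\<lambda>x y. ln ((A x y)\<^sup>2) / 2"] h
      partial_x_eqI[of "\<lambda>x y. ln ((A x y)\<^sup>2) / 2", OF lnx[OF that]] by auto
  have "partial_x F1 x y + F1 x y * partial_x h x y - (partial_x h x y)\<^sup>2
            - partial_x (partial_x h) x y - partial_y F x y - F x y * F2 x y = 0"
    if "x \<in> I" "y \<in> J" for x y
  proof -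
    have xy: "(x, y) \<in> I \<times> J" using that by simp
    note d = smooth2_on_has_partials(1)[OF _ xy] smooth2_on_has_partials(2)[OF _ xy]
      and p = smooth2_on_partials
    note nz = A0[OF xy]
    have "partial_x (partial_x h) x y = partial_x (\<lambda>x y. partial_x A x y / A x y) x y"
      by (rule partial_cong_open(1)[OF op xy hx])
    also have "\<dots> = (partial_x (partial_x A) x y * A x y - partial_x A x y * partial_x A x y) / (A x y * A x y)"
      by (intro partial_x_eqI DERIV_divide d A p nz)
    finally have 1: "partial_x (partial_x h) x y =
      (partial_x (partial_x A) x y * A x y - partial_x A x y * partial_x A x y) / (A x y * A x y)" .
    have "partial_x F1 x y = partial_x (\<lambda>x y. (partial_y B x y + partial_x A x y) / A x y) x y"
      by (rule partial_cong_open(1)[OF op xy cond(2)])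
    also have "\<dots> = ((partial_x (partial_y B) x y + partial_x (partial_x A) x y) * A x y
        - (partial_y B x y + partial_x A x y) * partial_x A x y) / (A x y * A x y)"
      by (intro partial_x_eqI DERIV_divide DERIV_add d A B p nz)
    finally have 2: "partial_x F1 x y = ((partial_x (partial_y B) x y + partial_x (partial_x A) x y) * A x y
        - (partial_y B x y + partial_x A x y) * partial_x A x y) / (A x y * A x y)" .
    have "partial_y F x y = partial_y (\<lambda>x y. partial_x B x y / A x y) x y"
      by (rule partial_cong_open(2)[OF op xy cond(3)])
    also have "\<dots> = (partial_y (partial_x B) x y * A x y - partial_x B x y * partial_y A x y) / (A x y * A x y)"
      by (intro partial_y_eqI DERIV_divide d A B p nz)
    finally have 3: "partial_y F x y =
      (partial_y (partial_x B) x y * A x y - partial_x B x y * partial_y A x y) / (A x y * A x y)" .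
    \<comment> \<open>After inserting the three quotient rules, all terms of the identity cancel
      except the difference of the two mixed partials of \<open>B\<close> divided by
      \<open>A\<close>.\<close>
    have 4: "partial_x (partial_y B) x y = partial_y (partial_x B) x y"
      using B that unfolding ab cd by (rule mixed_partials)
    show ?thesis
      unfolding 1 2 3 4 cond[OF xy] hx[OF xy] using nz
      by (simp add: field_simps power2_eq_square)
  qed
  then show ?R
    using rect IJU g unfolding h_def[abs_def] by (intro exI[of _ I] exI[of _ J] exI[of _ g]) (simp add: Let_def)
next
  assume ?R
  then obtain I J g where rect: "open_rectangle_around x0 y0 I J" and IJU: "I \<times> J \<subseteq> U"
    and g: "smooth1_on I g" and "let h = (\<lambda>x y. H x y + g x) in
        \<forall>x\<in>I. \<forall>y\<in>J.
          partial_x F1 x y + F1 x y * partial_x h x y - (partial_x h x y)\<^sup>2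
            - partial_x (partial_x h) x y - partial_y F x y - F x y * F2 x y = 0"
    by blast
  moreover define h where "h x y = H x y + g x" for x y
  ultimately have id: "partial_x F1 x y + F1 x y * partial_x h x y - (partial_x h x y)\<^sup>2
            - partial_x (partial_x h) x y - partial_y F x y - F x y * F2 x y = 0"
    if "(x, y) \<in> I \<times> J" for x y
    using that by (simp add: Let_def h_def[abs_def])
  from rect obtain a b c d where ab: "I = {a<..<b}" and cd: "J = {c<..<d}"
    and x0: "x0 \<in> I" and y0: "y0 \<in> J"
    unfolding open_rectangle_around_def by blast
  have op: "open (I \<times> J)" unfolding ab cd by (intro open_Times) auto
  have F: "smooth2_on (I \<times> J) F" and F1: "smooth2_on (I \<times> J) F1" and H: "smooth2_on (I \<times> J) H"
    using assms IJU smooth2_on_subset by blast+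
  have h: "smooth2_on (I \<times> J) h"
    using smooth1_on_imp_smooth2_on[OF op _ g] H
    by (auto simp: smooth2_on_def h_def[abs_def] intro!: Ck_on_add[OF op])
  have hy: "((\<lambda>s. h x s) has_real_derivative F2 x y) (at y)" if "(x, y) \<in> I \<times> J" for x y
    using DERIV_add[OF assms(7) DERIV_const, of x y "g x"] that IJU by (auto simp: h_def)
  note hx = smooth2_on_has_partials(1)[OF h]
  \<comment> \<open>The exponential makes the condition on \<open>F2\<close> automatic;
    \<open>E\<close> and \<open>G\<close> are the values that the other two conditions then force on
    the y- and the x-derivative of \<open>B\<close>.\<close>
  define A where "A x y = exp (h x y)" for x y
  define E where "E x y = A x y * (F1 x y - partial_x h x y)" for x y
  define G where "G x y = A x y * F x y" for x y
  have A: "smooth2_on (I \<times> J) A"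
    using h by (simp add: smooth2_on_def A_def[abs_def] Ck_on_exp[OF op])
  have E: "smooth2_on (I \<times> J) E"
    using A F1 smooth2_on_partials(1)[OF h]
    by (simp add: smooth2_on_def E_def[abs_def] Ck_on_mult[OF op] Ck_on_diff[OF op])
  have G: "smooth2_on (I \<times> J) G"
    using A F by (simp add: smooth2_on_def G_def[abs_def] Ck_on_mult[OF op])
  have Ax: "((\<lambda>s. A s y) has_real_derivative A x y * partial_x h x y) (at x)"
    and Ay: "((\<lambda>s. A x s) has_real_derivative A x y * F2 x y) (at y)" if "(x, y) \<in> I \<times> J" for x y
    unfolding A_def by (intro DERIV_fun_exp hx hy that)+
  \<comment> \<open>The integrability condition for \<open>B\<close> is the assumed identity
    multiplied by \<open>A\<close>.\<close>
  have closed: "partial_y G x y = partial_x E x y" if "(x, y) \<in> I \<times> J" for x y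
  proof -
    have "partial_y G x y = A x y * F2 x y * F x y + partial_y F x y * A x y"
      unfolding G_def by (intro partial_y_eqI DERIV_mult Ay smooth2_on_has_partials(2)[OF F] that)
    also have "\<dots> = A x y * (F2 x y * F x y + partial_y F x y)"
      by (simp add: algebra_simps)
    also have "F2 x y * F x y + partial_y F x y = partial_x h x y * (F1 x y - partial_x h x y) +
        (partial_x F1 x y - partial_x (partial_x h) x y)"
      using id[OF that] by (simp add: algebra_simps power2_eq_square)
    also have "A x y * \<dots> = A x y * partial_x h x y * (F1 x y - partial_x h x y) +
        (partial_x F1 x y - partial_x (partial_x h) x y) * A x y"
      by (simp add: algebra_simps)
    also have "\<dots> = partial_x E x y"
      unfolding E_def
      by (intro partial_x_eqI[symmetric] DERIV_mult DERIV_diff Ax smooth2_on_has_partials(1)[OF F1]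
          smooth2_on_has_partials(1)[OF smooth2_on_partials(1)[OF h]] that)
    finally show ?thesis .
  qed
  obtain B where B: "smooth2_on (I \<times> J) B" "\<And>x y. (x, y) \<in> I \<times> J \<Longrightarrow> partial_x B x y = G x y"
    "\<And>x y. (x, y) \<in> I \<times> J \<Longrightarrow> partial_y B x y = E x y"
    using poincare_rectangle[OF G[unfolded ab cd] E[unfolded ab cd] _ x0[unfolded ab] y0[unfolded cd]]
      closed unfolding ab cd by (metis mem_Sigma_iff)
  have A0: "A x y \<noteq> 0" for x y by (simp add: A_def)
  \<comment> \<open>With this sign the transport equation reads
    \<open>A \<psi>\<^sub>x = B \<psi>\<^sub>y\<close>, so that one function \<open>\<phi>\<close>
    can serve as the denominator of both \<open>A\<close> and \<open>B\<close>. Its solution may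
    require a smaller rectangle.\<close>
  define f where "f x y = - (B x y / A x y)" for x y
  have f: "smooth2_on ({a<..<b} \<times> {c<..<d}) f"
    using A B(1) unfolding smooth2_on_def f_def[abs_def] ab[symmetric] cd[symmetric]
    by (auto intro!: Ck_on_minus[OF op] Ck_on_divide[OF op] simp: A0)
  obtain I' J' \<psi> where rect': "open_rectangle_around x0 y0 I' J'" and sub: "I' \<subseteq> I" "J' \<subseteq> J"
    and \<psi>: "smooth2_on (I' \<times> J') \<psi>"
    and \<psi>y: "\<And>x y. x \<in> I' \<Longrightarrow> y \<in> J' \<Longrightarrow> 0 < partial_y \<psi> x y"
    and \<psi>x: "\<And>x y. x \<in> I' \<Longrightarrow> y \<in> J' \<Longrightarrow> partial_x \<psi> x y = - f x y * partial_y \<psi> x y"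
    using transport_equation_solution[OF f x0[unfolded ab] y0[unfolded cd]] unfolding ab cd by metis
  have op': "open (I' \<times> J')"
    using rect' unfolding open_rectangle_around_def by (auto intro!: open_Times)
  have sub': "I' \<times> J' \<subseteq> I \<times> J" using sub by blast
  define \<phi> where "\<phi> x y = partial_y \<psi> x y / A x y" for x y
  have \<phi>: "smooth2_on (I' \<times> J') \<phi>"
    using smooth2_on_partials(2)[OF \<psi>] smooth2_on_subset[OF A sub'] A0
    unfolding smooth2_on_def \<phi>_def[abs_def] by (auto intro!: Ck_on_divide[OF op'])
  have S: "sundman_transformation (I' \<times> J') \<psi> \<phi>"
    unfolding sundman_transformation_def using \<psi> \<phi> \<psi>y A0 by (fastforce simp: \<phi>_def)
  have "transforms_to_free_particle (I' \<times> J') F2 F1 F \<psi> \<phi>"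
  proof (rule transforms_to_free_particle_iff[OF op' S smooth2_on_subset[OF A sub'] _
        smooth2_on_subset[OF B(1) sub'], THEN iffD2])
    show "partial_y \<psi> x y = A x y * \<phi> x y" "partial_x \<psi> x y = B x y * \<phi> x y"
      if "(x, y) \<in> I' \<times> J'" for x y
      using \<psi>x[of x y] that A0[of x y] by (auto simp: \<phi>_def f_def)
    show "\<forall>(x, y)\<in>I' \<times> J'. A x y * F2 x y = partial_y A x y \<and>
       A x y * F1 x y = partial_y B x y + partial_x A x y \<and> A x y * F x y = partial_x B x y"
    proof clarify
      fix x y assume "x \<in> I'" "y \<in> J'"
      then have xy: "(x, y) \<in> I \<times> J" using sub by blast
      show "A x y * F2 x y = partial_y A x y \<and>
       A x y * F1 x y = partial_y B x y + partial_x A x y \<and> A x y * F x y = partial_x B x y"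
        unfolding B(2,3)[OF xy] partial_x_eqI[of A, OF Ax[OF xy]] partial_y_eqI[of A, OF Ay[OF xy]]
        by (simp add: E_def G_def algebra_simps)
    qed
  qed
  then show "S_linearizable_at U F2 F1 F x0 y0"
    unfolding S_linearizable_at_def using rect' S sub' IJU by blast
qed

end
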